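(* Let $d\ge3$, $\delta\in(0,1)$, and $\alpha>\frac34\cdot\frac{d-\frac23}{d-1}$ with $\alpha<1$. Then \[ \big\|\mathcal{L}(\mathcal{H}_\alpha)-\widetilde\nu_{\alpha,n}\big\|_{\mathrm{TV}}\to0\quad\text{as }n\to\infty. \]
   Context: Let $(\phi_x)$ be the discrete Gaussian free field on $[0,n]^d\cap\mathbb{Z}^d$ with zero boundary condition on $\partial[0,n]^d$: a centred Gaussian process with $\mathrm{Cov}(\phi_x,\phi_y)=\mathbb{E}_x\big[\sum_{i=0}^{\tau}\mathbf 1(X_i=y)\big]$, where $X$ is simple random walk on $[0,n]^d\cap\mathbb{Z}^d$ and $\tau$ its first hitting time of $\partial[0,n]^d\cap\mathbb{Z}^d$. Let $G$ be the Green's function of simple random walk on $\mathbb{Z}^d$ and $G(0)=G(0,0)$. The set of $\alpha$-high points is $\mathcal{H}_\alpha=\{x\in[\delta n,(1-\delta)n]^d\cap\mathbb{Z}^d:\phi_x\ge\sqrt{2\alpha dG(0)\log n}\}$. $\widetilde\nu_{\alpha,n}$ is the law of $\{x\in[\delta n,(1-\delta)n]^d\cap\mathbb{Z}^d:\widetilde Z_x=1\}$ where $(\widetilde Z_x)$ are independent Bernoulli with $\mathbb{P}(\widetilde Z_x=1)=\mathbb{P}(\phi_x\ge\sqrt{2\alpha dG(0)\log n})$. Total variation distance: $\|\mu-\nu\|_{\mathrm{TV}}=\max_A|\mu(A)-\nu(A)|$. *)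

theory Defs
  imports "HOL-Probability.Probability"
begin

text \<open>Lattice points of Z^d are vectors of type int ^ 'd; d = CARD('d).\<close>

definition lat_adj :: "int ^ 'd \<Rightarrow> int ^ 'd \<Rightarrow> bool" where
  "lat_adj x z \<longleftrightarrow> (\<Sum>i\<in>UNIV. \<bar>z $ i - x $ i\<bar>) = 1"

definition box_int :: "nat \<Rightarrow> (int ^ 'd::finite) set" where
  "box_int n = {x. \<forall>i. 0 < x $ i \<and> x $ i < int n}"

definition bulk :: "real \<Rightarrow> nat \<Rightarrow> (int ^ 'd::finite) set" where
  "bulk \<delta> n = {x. \<forall>i. \<delta> * real n \<le> real_of_int (x $ i) \<and> real_of_int (x $ i) \<le> (1 - \<delta>) * real n}"

text \<open>k-step transition probability of SRW on Z^d killed on exiting the interior of the box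
  (from interior x, stays in the interior up to time k, ends at y).\<close>
fun kill_step :: "nat \<Rightarrow> nat \<Rightarrow> int ^ 'd::finite \<Rightarrow> int ^ 'd \<Rightarrow> real" where
  "kill_step n 0 x y = (if x = y then 1 else 0)"
| "kill_step n (Suc k) x y =
     (\<Sum>z\<in>{z \<in> box_int n. lat_adj x z}. kill_step n k z y / (2 * real CARD('d)))"

text \<open>Green's function of SRW killed at the boundary: expected number of visits to y before tau,
  for interior points x, y.\<close>
definition green_box :: "nat \<Rightarrow> int ^ 'd::finite \<Rightarrow> int ^ 'd \<Rightarrow> real" where
  "green_box n x y = (\<Sum>k. kill_step n k x y)"

fun zd_step :: "nat \<Rightarrow> int ^ 'd::finite \<Rightarrow> int ^ 'd \<Rightarrow> real" where
  "zd_step 0 x y = (if x = y then 1 else 0)"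
| "zd_step (Suc k) x y = (\<Sum>z\<in>{z. lat_adj x z}. zd_step k z y / (2 * real CARD('d)))"

definition green0 :: "'d::finite itself \<Rightarrow> real" where
  "green0 _ = (\<Sum>k. zd_step k (0 :: int ^ 'd) 0)"

definition centred_gaussian_rv :: "'a measure \<Rightarrow> ('a \<Rightarrow> real) \<Rightarrow> real \<Rightarrow> bool" where
  "centred_gaussian_rv M X v \<longleftrightarrow> X \<in> borel_measurable M \<and>
     (if v = 0 then (AE \<omega> in M. X \<omega> = 0)
      else v > 0 \<and> distributed M lborel X (normal_density 0 (sqrt v)))"

text \<open>phi is a DGFF on [0,n]^d with zero boundary condition: a centred Gaussian process on the
  interior points with covariance green_box n (jointly Gaussian: every linear combination
  is centred Gaussian with the corresponding variance).  Boundary values are 0.\<close>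
definition is_dgff :: "nat \<Rightarrow> 'a measure \<Rightarrow> (int ^ 'd::finite \<Rightarrow> 'a \<Rightarrow> real) \<Rightarrow> bool" where
  "is_dgff n M \<phi> \<longleftrightarrow> prob_space M \<and>
     (\<forall>x. x \<notin> box_int n \<longrightarrow> (\<forall>\<omega>. \<phi> x \<omega> = 0)) \<and>
     (\<forall>c :: int ^ 'd \<Rightarrow> real.
        centred_gaussian_rv M (\<lambda>\<omega>. \<Sum>x\<in>box_int n. c x * \<phi> x \<omega>)
          (\<Sum>x\<in>box_int n. \<Sum>y\<in>box_int n. c x * c y * green_box n x y))"

definition hp_level :: "'d::finite itself \<Rightarrow> real \<Rightarrow> nat \<Rightarrow> real" where
  "hp_level t \<alpha> n = sqrt (2 * \<alpha> * real CARD('d) * green0 t * ln (real n))"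

definition high_points :: "real \<Rightarrow> real \<Rightarrow> nat \<Rightarrow> (int ^ 'd::finite \<Rightarrow> 'a \<Rightarrow> real) \<Rightarrow> 'a \<Rightarrow> (int ^ 'd) set" where
  "high_points \<delta> \<alpha> n \<phi> \<omega> = {x \<in> bulk \<delta> n. \<phi> x \<omega> \<ge> hp_level TYPE('d) \<alpha> n}"

definition bern_law :: "'a measure \<Rightarrow> real \<Rightarrow> real \<Rightarrow> nat \<Rightarrow> (int ^ 'd::finite \<Rightarrow> 'a \<Rightarrow> real)
    \<Rightarrow> (int ^ 'd) set set \<Rightarrow> real" where
  "bern_law M \<delta> \<alpha> n \<phi> A =
     (let p = (\<lambda>x. measure M {\<omega> \<in> space M. \<phi> x \<omega> \<ge> hp_level TYPE('d) \<alpha> n}) in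
      \<Sum>S\<in>A \<inter> Pow (bulk \<delta> n). (\<Prod>x\<in>S. p x) * (\<Prod>x\<in>bulk \<delta> n - S. 1 - p x))"

text \<open>Total variation distance between the law of H_alpha and nu~_{alpha,n}
  (both measures on subsets of the finite bulk; max over all events).\<close>
definition tv_high :: "'a measure \<Rightarrow> real \<Rightarrow> real \<Rightarrow> nat \<Rightarrow> (int ^ 'd::finite \<Rightarrow> 'a \<Rightarrow> real) \<Rightarrow> real" where
  "tv_high M \<delta> \<alpha> n \<phi> =
     Max ((\<lambda>A. \<bar>measure M {\<omega> \<in> space M. high_points \<delta> \<alpha> n \<phi> \<omega> \<in> A} - bern_law M \<delta> \<alpha> n \<phi> A\<bar>)
          ` Pow (Pow (bulk \<delta> n)))"

end

theory Submission
  imports Defs "HOL-Real_Asymp.Real_Asymp"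
begin

text \<open>Call \<open>x\<close> high if the field at \<open>x\<close> is above the level. Replacing the indicators of high points by
  independent copies one at a time bounds the total variation distance by the sum over \<open>x\<close> of the largest
  covariance between the indicator at \<open>x\<close> and a function of the other indicators bounded by 1. Given its
  value at \<open>x\<close>, the field is an independent residual plus a nonnegative multiple of that value, so the
  indicator at \<open>x\<close> is positively correlated with every increasing function of the set of high points; this
  bounds each such covariance by twice the sum of the covariances of pairs of indicators.

  A pair at bounded distance is high only if the sum of the two values exceeds twice the level. A
  superharmonic function bounds the correlation of distinct points by \<open>\<rho> = d / (2 (d - 1))\<close>, so that these
  pairs contribute \<open>n\<close> to the power \<open>d - 2 \<alpha> d / (1 + \<rho>)\<close>, which is negative exactly under the assumption
  on \<open>\<alpha>\<close>. For the remaining pairs the covariance is at most \<open>n\<close> to the power \<open>- 2 \<alpha> d + o(1)\<close> times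
  the Green's function, up to a term of order \<open>n\<close> to the power \<open>- 4 \<alpha> d\<close>. The Green's function sums to at
  most \<open>d n\<^sup>2\<close> over the box, and \<open>2 \<alpha> d > d + 2\<close>, so their contribution vanishes as well.\<close>

subsection \<open>Random walk killed outside a set\<close>

lemma lat_adj_iff:
  fixes x z :: "int ^ 'd::finite"
  shows "lat_adj x z \<longleftrightarrow> (\<exists>i. z = x + axis i 1 \<or> z = x - axis i 1)"
proof
  assume "lat_adj x z"
  then have total: "(\<Sum>i\<in>UNIV. \<bar>z $ i - x $ i\<bar>) = 1" by (simp add: lat_adj_def)
  then obtain j where j: "z $ j \<noteq> x $ j" by fastforce
  have split: "\<bar>z $ j - x $ j\<bar> + (\<Sum>i\<in>UNIV - {j}. \<bar>z $ i - x $ i\<bar>) = 1"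
    using total by (simp add: sum.remove[of UNIV j])
  moreover have "(\<Sum>i\<in>UNIV - {j}. \<bar>z $ i - x $ i\<bar>) \<ge> 0" by (simp add: sum_nonneg)
  ultimately have rest: "(\<Sum>i\<in>UNIV - {j}. \<bar>z $ i - x $ i\<bar>) = 0"
    and step: "z $ j - x $ j = 1 \<or> z $ j - x $ j = -1" using j by linarith+
  have "z $ i = x $ i" if "i \<noteq> j" for i
    using rest that by (subst (asm) sum_nonneg_eq_0_iff) auto
  then have "z = x + axis j (z $ j - x $ j)" by (auto simp: vec_eq_iff axis_def)
  moreover have "axis j (- 1 :: int) = - axis j 1" by (simp add: vec_eq_iff axis_def)
  ultimately show "\<exists>i. z = x + axis i 1 \<or> z = x - axis i 1" using step
    by (metis diff_conv_add_uminus)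
next
  assume "\<exists>i. z = x + axis i 1 \<or> z = x - axis i 1"
  then obtain i where "z = x + axis i 1 \<or> z = x - axis i 1" by blast
  then have "\<And>k. \<bar>z $ k - x $ k\<bar> = (if k = i then 1 else 0)" by (auto simp: axis_def)
  then show "lat_adj x z" by (simp add: lat_adj_def)
qed

lemma lat_adj_commute: "lat_adj x z \<longleftrightarrow> lat_adj z x"
  by (simp add: lat_adj_def abs_minus_commute)

lemma lat_adj_eq_range:
  "{z. lat_adj x z} = range (\<lambda>i. x + axis i 1) \<union> range (\<lambda>i. x - axis i (1::int))"
  by (auto simp: lat_adj_iff)

lemma finite_lat_adj [simp]: "finite {z. lat_adj x z}" "finite {z \<in> D. lat_adj x z}"
proof -
  show finite: "finite {z. lat_adj x z}" by (simp add: lat_adj_eq_range)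
  show "finite {z \<in> D. lat_adj x z}" by (rule finite_subset[OF _ finite]) auto
qed

lemma sum_lat_adj:
  fixes F :: "int ^ 'd::finite \<Rightarrow> 'b::comm_monoid_add"
  shows "(\<Sum>z | lat_adj x z. F z) = (\<Sum>i\<in>UNIV. F (x + axis i 1) + F (x - axis i 1))"
proof -
  have inj: "inj (\<lambda>i. x + axis i (1::int))" "inj (\<lambda>i. x - axis i (1::int))"
    by (auto simp: inj_on_def axis_eq_axis)
  have "x + axis i 1 \<noteq> x - axis j (1::int)" for i j
  proof
    assume "x + axis i 1 = x - axis j (1::int)"
    then have "(x + axis i 1) $ i = (x - axis j (1::int)) $ i" by simp
    then show False by (auto simp: axis_def split: if_splits)
  qed
  then have "range (\<lambda>i. x + axis i 1) \<inter> range (\<lambda>i. x - axis i (1::int)) = {}" by auto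
  then show ?thesis
    unfolding lat_adj_eq_range
    by (subst sum.union_disjoint)
      (simp_all add: sum.reindex[OF inj(1)] sum.reindex[OF inj(2)] sum.distrib)
qed

text \<open>\<open>(walk_mean D ^^ k) f x\<close> is the expectation of \<open>f\<close> at time \<open>k\<close> of the walk from \<open>x\<close> killed when
  it steps outside \<open>D\<close>.\<close>

definition walk_mean :: "(int ^ 'd::finite) set \<Rightarrow> (int ^ 'd \<Rightarrow> real) \<Rightarrow> int ^ 'd \<Rightarrow> real" where
  "walk_mean D f x = (\<Sum>z\<in>{z \<in> D. lat_adj x z}. f z) / (2 * real CARD('d))"

lemma walk_mean_mono: "(\<And>z. z \<in> D \<Longrightarrow> f z \<le> g z) \<Longrightarrow> walk_mean D f x \<le> walk_mean D g x"
  unfolding walk_mean_def by (intro divide_right_mono sum_mono) auto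

lemma walk_mean_mono_set:
  "D \<subseteq> D' \<Longrightarrow> (\<And>z. lat_adj x z \<Longrightarrow> 0 \<le> f z) \<Longrightarrow> walk_mean D f x \<le> walk_mean D' f x"
  unfolding walk_mean_def by (intro divide_right_mono sum_mono2) auto

lemma walk_mean_cmult: "walk_mean D (\<lambda>z. c * f z) x = c * walk_mean D f x"
  by (simp add: walk_mean_def sum_distrib_left)

lemma walk_mean_sum: "walk_mean D (\<lambda>z. \<Sum>i\<in>I. f i z) x = (\<Sum>i\<in>I. walk_mean D (f i) x)"
  by (simp add: walk_mean_def sum.swap[of _ I] sum_divide_distrib)

lemma walk_mean_UNIV:
  fixes f :: "int ^ 'd::finite \<Rightarrow> real"
  shows "walk_mean UNIV f x = (\<Sum>i\<in>UNIV. f (x + axis i 1) + f (x - axis i 1)) / (2 * real CARD('d))"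
  by (simp add: walk_mean_def sum_lat_adj)

lemma walk_mean_UNIV_translate: "walk_mean UNIV (\<lambda>z. f (z - y)) x = walk_mean UNIV f (x - y)"
  by (simp add: walk_mean_UNIV algebra_simps)

lemma walk_iterate_nonneg: "(\<And>z. 0 \<le> f z) \<Longrightarrow> 0 \<le> (walk_mean D ^^ k) f x"
  by (induction k arbitrary: x) (auto simp: walk_mean_def intro!: divide_nonneg_nonneg sum_nonneg)

lemma walk_iterate_mono_set:
  assumes "D \<subseteq> D'" and "\<And>z. 0 \<le> f z"
  shows "(walk_mean D ^^ k) f x \<le> (walk_mean D' ^^ k) f x"
proof (induction k arbitrary: x)
  case (Suc k)
  have "(walk_mean D ^^ Suc k) f x \<le> walk_mean D' ((walk_mean D ^^ k) f) x"
    using assms by (simp add: walk_mean_mono_set walk_iterate_nonneg)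
  also have "\<dots> \<le> (walk_mean D' ^^ Suc k) f x" by (simp add: walk_mean_mono Suc)
  finally show ?case .
qed simp

lemma walk_iterate_sum:
  "(walk_mean D ^^ k) (\<lambda>z. \<Sum>i\<in>I. f i z) = (\<lambda>x. \<Sum>i\<in>I. (walk_mean D ^^ k) (f i) x)"
  by (induction k) (auto simp: walk_mean_sum)

lemma walk_iterate_cmult: "(walk_mean D ^^ k) (\<lambda>z. c * f z) = (\<lambda>x. c * (walk_mean D ^^ k) f x)"
  by (induction k) (auto simp: walk_mean_cmult)

lemma walk_iterate_UNIV_translate:
  "(walk_mean UNIV ^^ k) (indicator {y}) x = (walk_mean UNIV ^^ k) (indicator {0}) (x - y)"
proof (induction k arbitrary: x)
  case (Suc k)
  then have "(walk_mean UNIV ^^ k) (indicator {y})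
      = (\<lambda>z. (walk_mean UNIV ^^ k) (indicator {0}) (z - y))"
    by blast
  then show ?case by (simp add: walk_mean_UNIV_translate)
qed (simp add: indicator_def)

lemma kill_step_eq_walk_iterate: "kill_step n k x y = (walk_mean (box_int n) ^^ k) (indicator {y}) x"
  by (induction k arbitrary: x) (simp_all add: walk_mean_def sum_divide_distrib indicator_def)

lemma zd_step_eq_walk_iterate: "zd_step k x y = (walk_mean UNIV ^^ k) (indicator {y}) x"
  by (induction k arbitrary: x) (simp_all add: walk_mean_def sum_divide_distrib indicator_def)

lemma walk_iterate_cong:
  "x \<in> D \<Longrightarrow> (\<And>z. z \<in> D \<Longrightarrow> f z = g z) \<Longrightarrow> (walk_mean D ^^ k) f x = (walk_mean D ^^ k) g x"
  by (induction k arbitrary: x) (simp_all add: walk_mean_def)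

lemma walk_iterate_indicator_sym:
  fixes x y :: "int ^ 'd::finite"
  assumes "x \<in> D" "y \<in> D"
  shows "(walk_mean D ^^ k) (indicator {y}) x = (walk_mean D ^^ k) (indicator {x}) y"
  using assms
proof (induction k arbitrary: x y)
  case (Suc k)
  let ?p = "1 / (2 * real CARD('d))"
  have first_step: "walk_mean D (indicator {y}) w = (\<Sum>z\<in>{z \<in> D. lat_adj y z}. ?p * indicator {z} w)"
    if "w \<in> D" for w
  proof -
    have "walk_mean D (indicator {y}) w = ?p * of_bool (lat_adj w y)"
      using Suc.prems by (simp add: walk_mean_def indicator_def of_bool_def)
    also have "of_bool (lat_adj w y) = (\<Sum>z\<in>{z \<in> D. lat_adj y z}. indicator {z} w)"
      using that by (simp add: indicator_def of_bool_def lat_adj_commute[of w y])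
    finally show ?thesis by (simp only: sum_distrib_left)
  qed
  have "(walk_mean D ^^ Suc k) (indicator {y}) x = (walk_mean D ^^ k) (walk_mean D (indicator {y})) x"
    by (simp add: funpow_swap1)
  also have "\<dots> = (\<Sum>z\<in>{z \<in> D. lat_adj y z}. ?p * (walk_mean D ^^ k) (indicator {z}) x)"
    by (simp only: walk_iterate_cong[OF Suc.prems(1) first_step] walk_iterate_sum walk_iterate_cmult)
  also have "\<dots> = (\<Sum>z\<in>{z \<in> D. lat_adj y z}. ?p * (walk_mean D ^^ k) (indicator {x}) z)"
    using Suc.prems by (intro sum.cong) (simp_all add: Suc.IH)
  also have "\<dots> = (walk_mean D ^^ Suc k) (indicator {x}) y"
    by (simp add: walk_mean_def sum_divide_distrib)
  finally show ?case .
qed (auto simp: indicator_def)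

text \<open>Maximum principle: the expectation of the sum of \<open>f\<close> along the walk up to its exit from \<open>D\<close>
  is below every nonnegative supersolution.\<close>

lemma sum_walk_iterates_le:
  assumes nonneg: "\<And>x. x \<in> D \<Longrightarrow> 0 \<le> F x"
    and super: "\<And>x. x \<in> D \<Longrightarrow> f x + walk_mean D F x \<le> F x"
    and "x \<in> D"
  shows "(\<Sum>k<K. (walk_mean D ^^ k) f x) \<le> F x"
  using \<open>x \<in> D\<close>
proof (induction K arbitrary: x)
  case (Suc K)
  have "(\<Sum>k<Suc K. (walk_mean D ^^ k) f x) = f x + walk_mean D (\<lambda>z. \<Sum>k<K. (walk_mean D ^^ k) f z) x"
    by (subst sum.lessThan_Suc_shift) (simp add: walk_mean_sum)
  also have "\<dots> \<le> f x + walk_mean D F x" by (intro add_left_mono walk_mean_mono Suc.IH)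
  also have "\<dots> \<le> F x" by (rule super[OF Suc.prems])
  finally show ?case .
qed (simp add: nonneg)

subsection \<open>A function superharmonic away from the origin\<close>

definition sqnorm :: "int ^ 'd::finite \<Rightarrow> real" where
  "sqnorm x = (\<Sum>i\<in>UNIV. (real_of_int (x $ i))\<^sup>2)"

lemma sqnorm_0 [simp]: "sqnorm 0 = 0"
  by (simp add: sqnorm_def)

lemma sqnorm_nonneg: "0 \<le> sqnorm x"
  by (simp add: sqnorm_def sum_nonneg)

lemma component_le_sqnorm: "(real_of_int (x $ i))\<^sup>2 \<le> sqnorm x"
  unfolding sqnorm_def by (rule member_le_sum) auto

lemma sqnorm_ge_1:
  assumes "x \<noteq> 0"
  shows "1 \<le> sqnorm x"
proof -
  obtain i where "x $ i \<noteq> 0" using assms by (auto simp: vec_eq_iff)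
  then have "1 \<le> \<bar>real_of_int (x $ i)\<bar>" by linarith
  then have "1 \<le> (real_of_int (x $ i))\<^sup>2" using one_le_power[of "\<bar>real_of_int (x $ i)\<bar>" 2] by simp
  then show ?thesis using component_le_sqnorm[of x i] by linarith
qed

lemma sqnorm_add_axis:
  "sqnorm (x + axis i 1) = sqnorm x + 1 + 2 * real_of_int (x $ i)"
  "sqnorm (x - axis i 1) = sqnorm x + 1 - 2 * real_of_int (x $ i)"
  by (simp_all add: sqnorm_def axis_def sum.remove[of UNIV i] power2_eq_square algebra_simps)

lemma sum_power4_le_sqnorm:
  fixes x :: "int ^ 'd::finite"
  shows "(\<Sum>i\<in>UNIV. (real_of_int (x $ i)) ^ 4) \<le> (sqnorm x)\<^sup>2"
proof -
  have "(\<Sum>i\<in>UNIV. (real_of_int (x $ i)) ^ 4)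
      = (\<Sum>i\<in>UNIV. (real_of_int (x $ i))\<^sup>2 * (real_of_int (x $ i))\<^sup>2)"
    by (simp add: power_add[symmetric])
  also have "\<dots> \<le> (\<Sum>i\<in>UNIV. (real_of_int (x $ i))\<^sup>2 * sqnorm x)"
    by (intro sum_mono mult_left_mono component_le_sqnorm) simp
  also have "\<dots> = (sqnorm x)\<^sup>2" by (simp add: sum_distrib_right[symmetric] power2_eq_square sqnorm_def)
  finally show ?thesis .
qed

lemma inverse_sqrt_sum_le:
  fixes t :: real
  assumes "t\<^sup>2 \<le> 1 / 4"
  shows "1 / sqrt (1 + t) + 1 / sqrt (1 - t) \<le> 2 + 3 / 4 * t\<^sup>2 + 3 / 4 * t ^ 4"
proof (rule power2_le_imp_le)
  define q where "q = t\<^sup>2"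
  have q: "0 \<le> q" "q \<le> 1 / 4" using assms by (auto simp: q_def)
  have "\<bar>t\<bar> \<le> 1 / 2" by (rule power2_le_imp_le) (use assms in \<open>simp_all add: power_divide\<close>)
  then have t: "0 < 1 + t" "0 < 1 - t" by linarith+
  have prod: "(1 + t) * (1 - t) = 1 - q" by (simp add: q_def power2_eq_square algebra_simps)
  have pos: "0 < 1 - q" using q by simp
  have sqrt_le: "sqrt (1 - q) \<le> 1 - q / 2 - q\<^sup>2 / 8"
  proof (rule real_le_lsqrt)
    have "q\<^sup>2 \<le> q" using q by (simp add: power2_eq_square mult_left_le)
    then show "0 \<le> 1 - q / 2 - q\<^sup>2 / 8" using q by linarith
    have "(1 - q / 2 - q\<^sup>2 / 8)\<^sup>2 = 1 - q + q ^ 3 / 8 + q ^ 4 / 64"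
      by (simp add: power2_eq_square power3_eq_cube power4_eq_xxxx algebra_simps)
    then show "1 - q \<le> (1 - q / 2 - q\<^sup>2 / 8)\<^sup>2" using q by simp
  qed
  have remainder: "0 \<le> 13 / 16 - 39 / 16 * q - 9 / 16 * q\<^sup>2 - 9 / 16 * q ^ 3"
    using power_mono[OF q(2) q(1), of 2] power_mono[OF q(2) q(1), of 3] q by (simp add: power_divide)
  have "(1 / sqrt (1 + t) + 1 / sqrt (1 - t))\<^sup>2
      = 1 / (1 + t) + 1 / (1 - t) + 2 / sqrt ((1 + t) * (1 - t))"
    using t by (simp add: power2_sum power_divide real_sqrt_mult)
  also have "\<dots> = (2 + 2 * sqrt (1 - q)) / (1 - q)"
  proof -
    have "1 / (1 + t) + 1 / (1 - t) = 2 / (1 - q)"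
      using t by (simp add: prod[symmetric] add_frac_eq)
    moreover have "2 / sqrt (1 - q) = 2 * sqrt (1 - q) / (1 - q)"
      using pos by (simp add: field_simps)
    ultimately show ?thesis unfolding prod by (simp add: add_divide_distrib)
  qed
  also have "\<dots> \<le> (4 - q - q\<^sup>2 / 4) / (1 - q)"
    using sqrt_le pos by (intro divide_right_mono) auto
  also have "\<dots> \<le> (2 + 3 / 4 * q + 3 / 4 * q\<^sup>2)\<^sup>2"
  proof -
    have "(2 + 3 / 4 * q + 3 / 4 * q\<^sup>2)\<^sup>2 * (1 - q)
        = (4 - q - q\<^sup>2 / 4) + q\<^sup>2 * (13 / 16 - 39 / 16 * q - 9 / 16 * q\<^sup>2 - 9 / 16 * q ^ 3)"
      by (simp add: power2_eq_square power3_eq_cube field_simps)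
    then show ?thesis using remainder pos by (simp add: divide_le_eq)
  qed
  finally show "(1 / sqrt (1 + t) + 1 / sqrt (1 - t))\<^sup>2 \<le> (2 + 3 / 4 * t\<^sup>2 + 3 / 4 * t ^ 4)\<^sup>2"
    by (simp add: q_def power_mult[symmetric])
qed simp

lemma shifted_inverse_sqrt_sum_le:
  fixes S y :: real
  assumes "0 < S" and "4 * \<bar>y\<bar> \<le> S"
  shows "1 / sqrt (S + 2 * y) + 1 / sqrt (S - 2 * y)
      \<le> (2 + 3 * y\<^sup>2 / S\<^sup>2 + 12 * y ^ 4 / S ^ 4) / sqrt S"
proof -
  define t where "t = 2 * y / S"
  have "\<bar>t\<bar> \<le> 1 / 2" using assms by (simp add: t_def abs_mult field_simps)
  then have "t\<^sup>2 \<le> 1 / 4" using power_mono[of "\<bar>t\<bar>" "1 / 2" 2] by (simp add: power_divide)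
  then have "(1 / sqrt (1 + t) + 1 / sqrt (1 - t)) / sqrt S
      \<le> (2 + 3 / 4 * t\<^sup>2 + 3 / 4 * t ^ 4) / sqrt S"
    using assms by (intro divide_right_mono inverse_sqrt_sum_le) auto
  moreover have "S + 2 * y = S * (1 + t)" "S - 2 * y = S * (1 - t)"
    using assms by (simp_all add: t_def field_simps)
  ultimately show ?thesis
    by (simp add: real_sqrt_mult add_divide_distrib mult.commute)
      (simp add: t_def power_divide power_mult_distrib)
qed

lemma inverse_sqrt_diff_1_ge:
  fixes S :: real
  assumes S: "1 < S"
  shows "(1 + 1 / (2 * S)) / sqrt S \<le> 1 / sqrt (S - 1)"
proof -
  have "(1 + 1 / (2 * S)) * sqrt (S - 1) \<le> sqrt S"
  proof (rule real_le_rsqrt)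
    have "((1 + 1 / (2 * S)) * sqrt (S - 1))\<^sup>2 = (1 + 1 / (2 * S))\<^sup>2 * (S - 1)"
      using S by (simp add: power_mult_distrib)
    also have "\<dots> = S - (3 * S + 1) / (4 * S\<^sup>2)"
      using S by (simp add: field_simps power2_eq_square)
    also have "\<dots> \<le> S" using S by simp
    finally show "((1 + 1 / (2 * S)) * sqrt (S - 1))\<^sup>2 \<le> S" .
  qed
  then show ?thesis using S by (simp add: field_simps)
qed

lemma walk_mean_inverse_sqrt_le:
  fixes x :: "int ^ 'd::finite"
  assumes d3: "CARD('d) \<ge> 3"
  shows "walk_mean UNIV (\<lambda>z. 1 / sqrt (sqnorm z + 3)) x \<le> 1 / sqrt (sqnorm x + 3)"
proof -
  define b S d where "b = sqnorm x" and "S = b + 4" and "d = real CARD('d)"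
  have S: "S \<ge> 4" "b \<le> S" "0 \<le> b" using sqnorm_nonneg[of x] by (auto simp: S_def b_def)
  have d: "d \<ge> 3" using d3 by (simp add: d_def)
  have "(\<Sum>i\<in>UNIV. 1 / sqrt (sqnorm (x + axis i 1) + 3) + 1 / sqrt (sqnorm (x - axis i 1) + 3))
      = (\<Sum>i\<in>UNIV. 1 / sqrt (S + 2 * real_of_int (x $ i)) + 1 / sqrt (S - 2 * real_of_int (x $ i)))"
    by (simp add: sqnorm_add_axis S_def b_def algebra_simps)
  also have "\<dots>
      \<le> (\<Sum>i\<in>UNIV. (2 + 3 * (real_of_int (x $ i))\<^sup>2 / S\<^sup>2 + 12 * (real_of_int (x $ i)) ^ 4 / S ^ 4) / sqrt S)"
  proof (intro sum_mono shifted_inverse_sqrt_sum_le)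
    fix i
    have "0 \<le> (\<bar>real_of_int (x $ i)\<bar> - 2)\<^sup>2" by simp
    then have "4 * \<bar>real_of_int (x $ i)\<bar> \<le> (real_of_int (x $ i))\<^sup>2 + 4"
      by (simp add: power2_eq_square algebra_simps)
    also have "\<dots> \<le> S" using component_le_sqnorm[of x i] by (simp add: S_def b_def)
    finally show "4 * \<bar>real_of_int (x $ i)\<bar> \<le> S" .
  qed (use S in simp)
  also have "\<dots> = (2 * d + 3 * b / S\<^sup>2 + 12 * (\<Sum>i\<in>UNIV. (real_of_int (x $ i)) ^ 4) / S ^ 4) / sqrt S"
    by (simp add: b_def sqnorm_def d_def sum.distrib sum_divide_distrib[symmetric] sum_distrib_left[symmetric])
  also have "\<dots> \<le> (2 * d + d / S) / sqrt S"
  proof -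
    have "12 * (\<Sum>i\<in>UNIV. (real_of_int (x $ i)) ^ 4) / S ^ 4 \<le> 12 * S\<^sup>2 / S ^ 4"
      using sum_power4_le_sqnorm[of x] power_mono[OF S(2,3), of 2]
      by (intro divide_right_mono) (auto simp: b_def)
    moreover have "3 * b / S\<^sup>2 + 12 * S\<^sup>2 / S ^ 4 = 3 / S"
    proof -
      have "12 * S\<^sup>2 / S ^ 4 = 12 / S\<^sup>2" using S by (simp add: power2_eq_square power4_eq_xxxx)
      moreover have "3 * b + 12 = 3 * S" by (simp add: S_def)
      ultimately show ?thesis using S by (simp add: add_divide_distrib[symmetric] power2_eq_square)
    qed
    moreover have "3 / S \<le> d / S" using d S by (intro divide_right_mono) auto
    ultimately show ?thesis using S by (intro divide_right_mono) auto
  qed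
  also have "\<dots> = 2 * d * ((1 + 1 / (2 * S)) / sqrt S)" using S by (simp add: field_simps)
  also have "\<dots> \<le> 2 * d * (1 / sqrt (S - 1))"
    using d S by (intro mult_left_mono inverse_sqrt_diff_1_ge) auto
  finally show ?thesis
    using d
    by (simp add: walk_mean_UNIV divide_le_eq S_def b_def d_def[symmetric] mult.commute add.commute)
qed

definition hit_ratio :: "'d::finite itself \<Rightarrow> real" where
  "hit_ratio _ = real CARD('d) / (2 * (real CARD('d) - 1))"

lemma hit_ratio_bounds:
  assumes "CARD('d::finite) \<ge> 3"
  shows "0 < hit_ratio TYPE('d)" "hit_ratio TYPE('d) < 1"
  using assms by (auto simp: hit_ratio_def)

text \<open>Bounds the probability that the walk from \<open>x\<close> ever visits the origin. The exponent is that of the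
  Green's function in dimension 3, and the shift by 3 makes the function superharmonic on the lattice.\<close>

definition hit_bound :: "int ^ 'd::finite \<Rightarrow> real" where
  "hit_bound x = (if x = 0 then 1 else hit_ratio TYPE('d) * (2 / sqrt (sqnorm x + 3)))"

lemma hit_bound_0 [simp]: "hit_bound 0 = 1"
  by (simp add: hit_bound_def)

lemma hit_bound_nonneg:
  fixes x :: "int ^ 'd::finite"
  assumes "CARD('d) \<ge> 3"
  shows "0 \<le> hit_bound x"
  using hit_ratio_bounds(1)[OF assms] sqnorm_nonneg[of x] by (simp add: hit_bound_def)

lemma hit_bound_le_hit_ratio:
  fixes x :: "int ^ 'd::finite"
  assumes "CARD('d) \<ge> 3" and "x \<noteq> 0"
  shows "hit_bound x \<le> hit_ratio TYPE('d)"
proof -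
  have "2 \<le> sqrt (sqnorm x + 3)" using sqnorm_ge_1[OF assms(2)] by (intro real_le_rsqrt) simp
  then show ?thesis
    using assms(2) hit_ratio_bounds(1)[OF assms(1)] sqnorm_nonneg[of x]
    by (simp add: hit_bound_def mult_le_cancel_left1 divide_le_eq)
qed

lemma walk_mean_hit_bound_0:
  "walk_mean UNIV hit_bound (0 :: int ^ 'd::finite) = hit_ratio TYPE('d)"
proof -
  have "sqnorm (axis i 1 :: int ^ 'd) = 1" "sqnorm (- axis i 1 :: int ^ 'd) = 1" for i
    using sqnorm_add_axis[of "0 :: int ^ 'd" i] by simp_all
  then show ?thesis by (simp add: walk_mean_UNIV hit_bound_def)
qed

text \<open>The value \<open>1\<close> at the origin exceeds that of the superharmonic function, which matters only to the
  neighbours of the origin.\<close>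

lemma walk_mean_hit_bound_unit_le:
  fixes x :: "int ^ 'd::finite"
  assumes d3: "CARD('d) \<ge> 3" and adj: "lat_adj x 0"
  shows "walk_mean UNIV hit_bound x \<le> hit_ratio TYPE('d)"
proof -
  define d \<rho> where "d = real CARD('d)" and "\<rho> = hit_ratio TYPE('d)"
  have d: "d \<ge> 3" using d3 by (simp add: d_def)
  have \<rho>: "0 < \<rho>" "2 * (d - 1) * \<rho> = d"
    using hit_ratio_bounds(1)[OF d3] d by (auto simp: \<rho>_def d_def[symmetric] hit_ratio_def)
  obtain j where "0 = x + axis j 1 \<or> 0 = x - axis j 1" using adj by (auto simp: lat_adj_iff)
  then have x: "x = - axis j 1 \<or> x = axis j 1"
    by (metis add_eq_0_iff add.inverse_inverse eq_iff_diff_eq_0)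
  then have sqnorm_x: "sqnorm x = 1" and component_eq_0: "x $ i = 0 \<longleftrightarrow> i \<noteq> j" for i
    using sqnorm_add_axis[of "0 :: int ^ 'd" j] by (auto simp: axis_def)
  define pair where "pair = (\<lambda>i. hit_bound (x + axis i 1) + hit_bound (x - axis i 1))"
  have hit_bound_eq: "hit_bound z = \<rho> * (2 / sqrt (sqnorm z + 3))" if "sqnorm z \<noteq> 0" for z :: "int ^ 'd"
    using that by (auto simp: hit_bound_def \<rho>_def)
  have pair_j: "pair j = 1 + \<rho> * (2 / sqrt 7)"
    using x sqnorm_add_axis[of x j] sqnorm_x
    by (auto simp: pair_def hit_bound_eq axis_def)
  have pair_other: "pair i = 2 * (\<rho> * (2 / sqrt 5))" if "i \<noteq> j" for i
    using sqnorm_add_axis[of x i] component_eq_0[of i] that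
    by (simp add: pair_def hit_bound_eq sqnorm_x)
  have root_bounds: "2 / sqrt 7 \<le> 4 / (5 :: real)" "2 / sqrt 5 \<le> 9 / (10 :: real)"
    using real_le_rsqrt[of "5 / 2" 7] real_le_rsqrt[of "20 / 9" 5]
    by (simp_all add: field_simps power2_eq_square)
  have "(\<Sum>i\<in>UNIV. pair i) = pair j + (\<Sum>i\<in>UNIV - {j}. pair i)" by (simp add: sum.remove[of UNIV j])
  also have "(\<Sum>i\<in>UNIV - {j}. pair i) = (d - 1) * (2 * (\<rho> * (2 / sqrt 5)))"
    by (simp add: pair_other card_Diff_subset of_nat_diff d_def)
  also have "pair j + \<dots> \<le> (1 + \<rho> * (4 / 5)) + (d - 1) * (2 * (\<rho> * (9 / 10)))"
    unfolding pair_j by (intro add_mono mult_left_mono root_bounds) (use \<rho>(1) d in auto)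
  also have "\<dots> = 1 + \<rho> * (4 / 5) + d * (9 / 10)" using \<rho>(2) by (simp add: algebra_simps)
  also have "\<dots> \<le> 2 * d * \<rho>"
  proof -
    have "(d - 1) * (d / 10 + 6 / 5 * \<rho> - 1) = (d - 5 / 2)\<^sup>2 / 10 + 3 / 8"
      using \<rho>(2) by (simp add: power2_eq_square field_simps)
    then have "0 \<le> (d - 1) * (d / 10 + 6 / 5 * \<rho> - 1)" by simp
    then have "1 \<le> d / 10 + 6 / 5 * \<rho>" using d by (simp add: zero_le_mult_iff)
    moreover have "2 * d * \<rho> = d + 2 * \<rho>" using \<rho>(2) by (simp add: algebra_simps)
    ultimately show ?thesis by linarith
  qed
  finally show ?thesis using d
    by (simp add: walk_mean_UNIV pair_def divide_le_eq d_def[symmetric] \<rho>_def[symmetric] mult.commute)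
qed

lemma walk_mean_hit_bound_le:
  fixes x :: "int ^ 'd::finite"
  assumes d3: "CARD('d) \<ge> 3" and "x \<noteq> 0"
  shows "walk_mean UNIV hit_bound x \<le> hit_bound x"
proof (cases "lat_adj x 0")
  case True
  then obtain i where "x = axis i 1 \<or> x = - axis i 1"
    by (metis lat_adj_commute lat_adj_iff add_0 diff_0)
  then have "hit_bound x = hit_ratio TYPE('d)"
    using sqnorm_add_axis[of "0 :: int ^ 'd" i] assms(2) by (auto simp: hit_bound_def)
  then show ?thesis using walk_mean_hit_bound_unit_le[OF d3 True] by simp
next
  case False
  have "walk_mean UNIV hit_bound x
      = walk_mean UNIV (\<lambda>z. 2 * hit_ratio TYPE('d) * (1 / sqrt (sqnorm z + 3))) x"
    using False unfolding walk_mean_def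
    by (intro arg_cong[where f = "\<lambda>s. s / _"] sum.cong) (auto simp: hit_bound_def)
  also have "\<dots> \<le> 2 * hit_ratio TYPE('d) * (1 / sqrt (sqnorm x + 3))"
    unfolding walk_mean_cmult
    using hit_ratio_bounds(1)[OF d3] by (intro mult_left_mono walk_mean_inverse_sqrt_le[OF d3]) simp
  also have "\<dots> = hit_bound x" using assms(2) by (simp add: hit_bound_def)
  finally show ?thesis .
qed

subsection \<open>The Green's function of the killed walk\<close>

definition walk_green :: "(int ^ 'd::finite) set \<Rightarrow> int ^ 'd \<Rightarrow> int ^ 'd \<Rightarrow> real" where
  "walk_green D x y = (\<Sum>k. (walk_mean D ^^ k) (indicator {y}) x)"

lemma green_box_eq_walk_green: "green_box n = walk_green (box_int n)"
  by (simp add: green_box_def walk_green_def kill_step_eq_walk_iterate fun_eq_iff)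

lemma green0_eq_walk_green: "green0 TYPE('d::finite) = walk_green UNIV (0 :: int ^ 'd) 0"
  by (simp add: green0_def walk_green_def zd_step_eq_walk_iterate)

lemma walk_green_sym: "x \<in> D \<Longrightarrow> y \<in> D \<Longrightarrow> walk_green D x y = walk_green D y x"
  by (simp add: walk_green_def walk_iterate_indicator_sym)

lemma walk_green_UNIV_translate: "walk_green UNIV x y = walk_green UNIV (x - y) 0"
  by (simp add: walk_green_def flip: walk_iterate_UNIV_translate)

lemma sum_walk_iterates_le_hit_bound:
  fixes x y :: "int ^ 'd::finite"
  assumes d3: "CARD('d) \<ge> 3"
  shows "(\<Sum>k<K. (walk_mean UNIV ^^ k) (indicator {y}) x) \<le> hit_bound (x - y) / (1 - hit_ratio TYPE('d))"
proof (rule sum_walk_iterates_le)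
  fix x
  have \<rho>: "0 < 1 - hit_ratio TYPE('d)" using hit_ratio_bounds(2)[OF d3] by simp
  show "0 \<le> hit_bound (x - y) / (1 - hit_ratio TYPE('d))"
    using \<rho> hit_bound_nonneg[OF d3, of "x - y"] by simp
  have "walk_mean UNIV (\<lambda>z. hit_bound (z - y) / (1 - hit_ratio TYPE('d))) x
      = walk_mean UNIV hit_bound (x - y) / (1 - hit_ratio TYPE('d))"
    using walk_mean_cmult[of UNIV "1 / (1 - hit_ratio TYPE('d))" "\<lambda>z. hit_bound (z - y)" x]
    by (simp add: walk_mean_UNIV_translate)
  moreover have "(1 - hit_ratio TYPE('d)) * indicator {y} x + walk_mean UNIV hit_bound (x - y)
      \<le> hit_bound (x - y)"
    using walk_mean_hit_bound_le[OF d3, of "x - y"]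
    by (cases "x = y") (auto simp: walk_mean_hit_bound_0)
  ultimately show "indicator {y} x + walk_mean UNIV (\<lambda>z. hit_bound (z - y) / (1 - hit_ratio TYPE('d))) x
      \<le> hit_bound (x - y) / (1 - hit_ratio TYPE('d))"
    using \<rho> by (simp add: field_simps)
qed simp

lemma summable_walk_iterates:
  fixes x y :: "int ^ 'd::finite"
  assumes d3: "CARD('d) \<ge> 3"
  shows "summable (\<lambda>k. (walk_mean D ^^ k) (indicator {y}) x)"
proof (rule summableI_nonneg_bounded)
  show "(\<Sum>k<K. (walk_mean D ^^ k) (indicator {y}) x)
      \<le> hit_bound (x - y) / (1 - hit_ratio TYPE('d))" for K
    by (rule order_trans[OF sum_mono sum_walk_iterates_le_hit_bound[OF d3]])
      (simp add: walk_iterate_mono_set)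
qed (simp add: walk_iterate_nonneg)

lemma walk_green_nonneg:
  fixes x y :: "int ^ 'd::finite"
  assumes d3: "CARD('d) \<ge> 3"
  shows "0 \<le> walk_green D x y"
  unfolding walk_green_def by (intro suminf_nonneg summable_walk_iterates d3 walk_iterate_nonneg) simp

lemma walk_green_mono:
  fixes x y :: "int ^ 'd::finite"
  assumes d3: "CARD('d) \<ge> 3" and "D \<subseteq> D'"
  shows "walk_green D x y \<le> walk_green D' x y"
  unfolding walk_green_def
  by (intro suminf_le summable_walk_iterates d3 walk_iterate_mono_set assms(2)) simp

lemma walk_green_le_green0:
  fixes x :: "int ^ 'd::finite"
  assumes d3: "CARD('d) \<ge> 3"
  shows "walk_green D x x \<le> green0 TYPE('d)"
  using walk_green_mono[OF d3, of D UNIV x x] walk_green_UNIV_translate[of x x]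
  by (simp add: green0_eq_walk_green)

lemma walk_green_le_hit_bound:
  fixes x y :: "int ^ 'd::finite"
  assumes d3: "CARD('d) \<ge> 3"
  shows "walk_green D x y \<le> hit_bound (x - y) / (1 - hit_ratio TYPE('d))"
proof -
  have "walk_green D x y \<le> walk_green UNIV x y" by (rule walk_green_mono[OF d3]) simp
  also have "\<dots> \<le> hit_bound (x - y) / (1 - hit_ratio TYPE('d))"
    unfolding walk_green_def
    by (intro suminf_le_const summable_walk_iterates sum_walk_iterates_le_hit_bound d3)
  finally show ?thesis .
qed

lemma walk_green_first_step:
  fixes x y :: "int ^ 'd::finite"
  assumes d3: "CARD('d) \<ge> 3"
  shows "walk_green D x y = indicator {y} x + walk_mean D (\<lambda>z. walk_green D z y) x"
proof -
  have "walk_green D x y = indicator {y} x + (\<Sum>k. walk_mean D ((walk_mean D ^^ k) (indicator {y})) x)"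
    using suminf_split_head[OF summable_walk_iterates[OF d3], of D y x] by (simp add: walk_green_def)
  also have "(\<Sum>k. walk_mean D ((walk_mean D ^^ k) (indicator {y})) x)
      = walk_mean D (\<lambda>z. walk_green D z y) x"
    by (simp add: walk_mean_def[of D _ x] walk_green_def suminf_divide suminf_sum summable_sum
        summable_walk_iterates[OF d3])
  finally show ?thesis .
qed

lemma walk_green_diag_ge_1:
  fixes x :: "int ^ 'd::finite"
  assumes d3: "CARD('d) \<ge> 3"
  shows "1 \<le> walk_green D x x"
  using walk_mean_mono[of D "\<lambda>_. 0" "\<lambda>z. walk_green D z x" x] walk_green_nonneg[OF d3]
  by (subst walk_green_first_step[OF d3]) (simp add: walk_mean_def)

text \<open>The minimum of the Green's function and a multiple of \<open>hit_bound\<close> is a supersolution of the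
  equation whose least nonnegative solution is the Green's function.\<close>

lemma walk_green_le_hit_bound_diag:
  fixes x y :: "int ^ 'd::finite"
  assumes d3: "CARD('d) \<ge> 3" and "x \<in> D"
  shows "walk_green D x y \<le> hit_bound (x - y) * walk_green D y y"
proof -
  define m where "m = walk_green D y y"
  define F where "F = (\<lambda>x. min (walk_green D x y) (m * hit_bound (x - y)))"
  have m: "0 \<le> m" using walk_green_nonneg[OF d3] by (simp add: m_def)
  have hit_nonneg: "0 \<le> m * hit_bound z" for z :: "int ^ 'd" using m hit_bound_nonneg[OF d3] by simp
  have "(\<Sum>k<K. (walk_mean D ^^ k) (indicator {y}) x) \<le> F x" for K
  proof (rule sum_walk_iterates_le[OF _ _ \<open>x \<in> D\<close>])
    fix x
    show "0 \<le> F x" using walk_green_nonneg[OF d3] hit_nonneg by (simp add: F_def)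
    have "walk_mean D F x \<le> walk_mean D (\<lambda>z. walk_green D z y) x"
      by (rule walk_mean_mono) (simp add: F_def)
    then have green: "indicator {y} x + walk_mean D F x \<le> walk_green D x y"
      using walk_green_first_step[OF d3, of D x y] by simp
    show "indicator {y} x + walk_mean D F x \<le> F x"
    proof (cases "x = y")
      case False
      have "walk_mean D F x \<le> walk_mean D (\<lambda>z. m * hit_bound (z - y)) x"
        by (rule walk_mean_mono) (simp add: F_def)
      also have "\<dots> \<le> walk_mean UNIV (\<lambda>z. m * hit_bound (z - y)) x"
        using hit_nonneg by (intro walk_mean_mono_set) auto
      also have "\<dots> \<le> m * hit_bound (x - y)"
        unfolding walk_mean_cmult walk_mean_UNIV_translate
        using False m by (intro mult_left_mono walk_mean_hit_bound_le[OF d3]) auto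
      finally show ?thesis using green False by (simp add: F_def)
    qed (use green in \<open>simp add: F_def m_def\<close>)
  qed
  then have "walk_green D x y \<le> F x"
    unfolding walk_green_def by (intro suminf_le_const summable_walk_iterates d3)
  then show ?thesis by (simp add: F_def m_def mult.commute)
qed

lemma walk_green_le_hit_ratio:
  fixes x y :: "int ^ 'd::finite"
  assumes d3: "CARD('d) \<ge> 3" and "x \<in> D" and "x \<noteq> y"
  shows "walk_green D x y \<le> hit_ratio TYPE('d) * green0 TYPE('d)"
proof -
  have "walk_green D x y \<le> hit_bound (x - y) * walk_green D y y"
    by (rule walk_green_le_hit_bound_diag[OF d3 assms(2)])
  also have "\<dots> \<le> hit_ratio TYPE('d) * green0 TYPE('d)"
    using assms(3) hit_ratio_bounds(1)[OF d3] walk_green_nonneg[OF d3]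
    by (intro mult_mono hit_bound_le_hit_ratio d3 walk_green_le_green0) auto
  finally show ?thesis .
qed

lemma sum_walk_green_le:
  fixes x :: "int ^ 'd::finite"
  assumes d3: "CARD('d) \<ge> 3" and "finite D" and "x \<in> D"
    and "\<And>z. z \<in> D \<Longrightarrow> 0 \<le> F z" and "\<And>z. z \<in> D \<Longrightarrow> 1 + walk_mean D F z \<le> F z"
  shows "(\<Sum>y\<in>D. walk_green D x y) \<le> F x"
proof -
  have "(\<Sum>y\<in>D. walk_green D x y) = (\<Sum>k. \<Sum>y\<in>D. (walk_mean D ^^ k) (indicator {y}) x)"
    unfolding walk_green_def by (intro suminf_sum[symmetric] summable_walk_iterates d3)
  also have "\<dots> \<le> F x"
  proof (intro suminf_le_const summable_sum summable_walk_iterates d3)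
    fix K
    have "(\<Sum>y\<in>D. indicator {y} z) = (1 :: real)" if "z \<in> D" for z
      using assms(2) that by (simp add: indicator_def of_bool_def)
    then have "(\<Sum>k<K. (walk_mean D ^^ k) (\<lambda>z. \<Sum>y\<in>D. indicator {y} z) x) \<le> F x"
      using assms by (intro sum_walk_iterates_le) auto
    then show "(\<Sum>k<K. \<Sum>y\<in>D. (walk_mean D ^^ k) (indicator {y}) x) \<le> F x"
      by (simp add: walk_iterate_sum)
  qed
  finally show ?thesis .
qed

lemma finite_card_vec_box:
  fixes S :: "'d::finite \<Rightarrow> 'b set"
  assumes "\<And>i. finite (S i)"
  shows "finite {x :: 'b ^ 'd. \<forall>i. x $ i \<in> S i}"
    and "card {x :: 'b ^ 'd. \<forall>i. x $ i \<in> S i} = (\<Prod>i\<in>UNIV. card (S i))"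
proof -
  have image: "{x :: 'b ^ 'd. \<forall>i. x $ i \<in> S i} = vec_lambda ` PiE UNIV S"
    by (auto simp: image_iff Pi_iff intro!: bexI[of _ "vec_nth _"])
  show "finite {x :: 'b ^ 'd. \<forall>i. x $ i \<in> S i}"
    unfolding image using assms by (intro finite_imageI finite_PiE) auto
  show "card {x :: 'b ^ 'd. \<forall>i. x $ i \<in> S i} = (\<Prod>i\<in>UNIV. card (S i))"
    unfolding image by (subst card_image) (auto simp: inj_on_def vec_lambda_inject card_PiE)
qed

lemma box_int_eq: "box_int n = {x. \<forall>i. x $ i \<in> {0<..<int n}}"
  by (simp add: box_int_def)

lemma finite_box_int [simp]: "finite (box_int n)"
  unfolding box_int_eq by (rule finite_card_vec_box) simp

lemma card_box_int_le: "card (box_int n :: (int ^ 'd::finite) set) \<le> n ^ CARD('d)"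
  unfolding box_int_eq by (subst finite_card_vec_box) (auto intro: power_mono)

text \<open>In each coordinate, \<open>d t (n - t)\<close> is the expected exit time of the walk from the slab
  \<open>0 < t < n\<close>.\<close>

lemma sum_green_box_le:
  fixes x :: "int ^ 'd::finite"
  assumes d3: "CARD('d) \<ge> 3" and x: "x \<in> box_int n"
  shows "(\<Sum>y\<in>box_int n. green_box n x y) \<le> real CARD('d) * (real n)\<^sup>2"
proof -
  define j :: 'd where "j = undefined"
  define exit_time where
    "exit_time z = real CARD('d) * (real_of_int (z $ j) * (real n - real_of_int (z $ j)))" for z :: "int ^ 'd"
  have slab: "0 < z $ j" "z $ j < int n" if "z \<in> box_int n" for z :: "int ^ 'd"
    using that by (auto simp: box_int_def)
  have "(\<Sum>y\<in>box_int n. green_box n x y) \<le> exit_time x"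
    unfolding green_box_eq_walk_green
  proof (rule sum_walk_green_le[OF d3 finite_box_int x])
    fix z :: "int ^ 'd" assume z: "z \<in> box_int n"
    show "0 \<le> exit_time z"
      using slab[OF z] by (auto simp: exit_time_def intro!: mult_nonneg_nonneg)
    have "walk_mean (box_int n) exit_time z \<le> walk_mean UNIV exit_time z"
    proof (rule walk_mean_mono_set)
      fix w assume "lat_adj z w"
      then have "0 \<le> w $ j" "w $ j \<le> int n"
        using slab[OF z] by (auto simp: lat_adj_iff axis_def split: if_splits)
      then show "0 \<le> exit_time w" by (auto simp: exit_time_def intro!: mult_nonneg_nonneg)
    qed simp
    also have "walk_mean UNIV exit_time z = exit_time z - 1"
    proof -
      have "(\<Sum>i\<in>UNIV. exit_time (z + axis i 1) + exit_time (z - axis i 1))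
          = (\<Sum>i\<in>UNIV. 2 * exit_time z - (if i = j then 2 * real CARD('d) else 0))"
        by (intro sum.cong) (auto simp: exit_time_def axis_def algebra_simps)
      also have "\<dots> = 2 * real CARD('d) * (exit_time z - 1)" by (simp add: sum_subtractf algebra_simps)
      finally show ?thesis by (simp add: walk_mean_UNIV)
    qed
    finally show "1 + walk_mean (box_int n) exit_time z \<le> exit_time z" by simp
  qed
  also have "exit_time x \<le> real CARD('d) * (real n)\<^sup>2"
    using slab[OF x] unfolding exit_time_def power2_eq_square by (intro mult_left_mono mult_mono) auto
  finally show ?thesis .
qed

definition sup_ball :: "nat \<Rightarrow> int ^ 'd::finite \<Rightarrow> (int ^ 'd) set" where
  "sup_ball r x = {y. \<forall>i. \<bar>x $ i - y $ i\<bar> \<le> int r}"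

lemma finite_card_sup_ball:
  fixes x :: "int ^ 'd::finite"
  shows "finite (sup_ball r x)" "card (sup_ball r x) = (2 * r + 1) ^ CARD('d)"
proof -
  have eq: "sup_ball r x = {y. \<forall>i. y $ i \<in> {x $ i - int r..x $ i + int r}}"
    unfolding sup_ball_def by (intro Collect_cong all_cong1) auto
  show "finite (sup_ball r x)" unfolding eq by (rule finite_card_vec_box) simp
  show "card (sup_ball r x) = (2 * r + 1) ^ CARD('d)"
    unfolding eq finite_card_vec_box(2)[OF finite_atLeastAtMost_int]
    by (simp add: nat_add_distrib nat_mult_distrib)
qed

lemma green_box_le_far:
  fixes \<epsilon> :: real
  assumes d3: "CARD('d::finite) \<ge> 3" and "\<epsilon> > 0"
  obtains r :: nat where "\<And>n (x :: int ^ 'd) y. y \<notin> sup_ball r x \<Longrightarrow> green_box n x y \<le> \<epsilon>"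
proof -
  define \<rho> where "\<rho> = hit_ratio TYPE('d)"
  have \<rho>: "0 < \<rho>" "\<rho> < 1" using hit_ratio_bounds[OF d3] by (auto simp: \<rho>_def)
  define C where "C = 2 * \<rho> / (\<epsilon> * (1 - \<rho>))"
  obtain r :: nat where r: "C < real r" using reals_Archimedean2 by blast
  have "green_box n x y \<le> \<epsilon>" if outside: "y \<notin> sup_ball r x" for n and x y :: "int ^ 'd"
  proof -
    obtain i where far: "int r < \<bar>x $ i - y $ i\<bar>" using outside by (auto simp: sup_ball_def not_le)
    have C: "0 < C" using \<rho> assms(2) by (simp add: C_def)
    have "C \<le> \<bar>real_of_int ((x - y) $ i)\<bar>" using far r by simp
    then have "C\<^sup>2 \<le> (real_of_int ((x - y) $ i))\<^sup>2" using C by (simp add: abs_le_square_iff[symmetric])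
    then have "C \<le> sqrt (sqnorm (x - y) + 3)"
      using component_le_sqnorm[of "x - y" i] by (intro real_le_rsqrt) simp
    moreover have "x - y \<noteq> 0" using far by auto
    ultimately have "hit_bound (x - y) \<le> \<rho> * (2 / C)"
      using \<rho> C by (auto simp: hit_bound_def \<rho>_def[symmetric] intro!: mult_left_mono frac_le)
    also have "\<dots> = \<epsilon> * (1 - \<rho>)" using \<rho> by (simp add: C_def)
    finally have "hit_bound (x - y) / (1 - \<rho>) \<le> \<epsilon>" using \<rho> by (simp add: divide_le_eq)
    then show ?thesis using walk_green_le_hit_bound[OF d3, of "box_int n" x y]
      by (simp add: \<rho>_def green_box_eq_walk_green)
  qed
  then show ?thesis by (rule that)
qed

subsection \<open>Characteristic functions determine finite-dimensional laws\<close>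

lemma (in finite_measure) integrable_norm_le:
  fixes f :: "'a \<Rightarrow> 'b::{banach, second_countable_topology}"
  shows "f \<in> borel_measurable M \<Longrightarrow> (\<And>x. norm (f x) \<le> c) \<Longrightarrow> integrable M f"
  by (rule integrable_const_bound) auto

lemma real_distribution_normalized:
  fixes M :: "real measure"
  assumes "finite_measure M" and m: "m = measure M (space M)" "0 < m" and borel: "sets M = sets borel"
  shows "real_distribution (density M (\<lambda>_. ennreal (1 / m)))"
proof -
  interpret finite_measure M by fact
  let ?P = "density M (\<lambda>_. ennreal (1 / m))"
  have "emeasure ?P (space ?P) = 1"
    using m by (simp add: emeasure_density_const emeasure_eq_measure ennreal_mult[symmetric])
  then interpret prob_space ?P by (rule prob_spaceI)
  show ?thesis using borel sets_eq_imp_space_eq[OF borel] by unfold_locales auto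
qed

lemma finite_measure_eqI_char:
  fixes M N :: "real measure"
  assumes "finite_measure M" "finite_measure N"
    and borel [simp, measurable_cong]: "sets M = sets borel" "sets N = sets borel"
    and char: "char M = char N"
  shows "M = N"
proof -
  interpret M: finite_measure M by fact
  interpret N: finite_measure N by fact
  define m where "m = measure M (space M)"
  have mass: "m = measure N (space N)"
    using fun_cong[OF char, of 0] by (simp add: m_def char_def)
  show ?thesis
  proof (cases "m = 0")
    case True
    then have "emeasure M (space M) = 0" "emeasure N (space N) = 0"
      using mass by (simp_all add: m_def M.emeasure_eq_measure N.emeasure_eq_measure)
    then have "emeasure M A = 0" "emeasure N A = 0" for A
      by (metis emeasure_space le_zero_eq)+
    then show ?thesis by (intro measure_eqI) auto
  next
    case False
    then have m: "0 < m" by (simp add: m_def less_le)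
    let ?normalized = "\<lambda>P :: real measure. density P (\<lambda>_. ennreal (1 / m))"
    have "char (?normalized P) t = char P t / m" if [measurable_cong]: "sets P = sets borel" for P t
      using m unfolding char_def by (subst integral_density) (auto simp: scaleR_conv_of_real)
    then have "?normalized M = ?normalized N"
      using real_distribution_normalized[OF assms(1) m_def m]
        real_distribution_normalized[OF assms(2) mass m]
      by (intro Levy_uniqueness ext) (simp_all add: char)
    then have "emeasure (?normalized M) A = emeasure (?normalized N) A" for A by simp
    then have "ennreal (1 / m) * emeasure M A = ennreal (1 / m) * emeasure N A"
      if "A \<in> sets borel" for A
      using that emeasure_density_const[of A M "ennreal (1 / m)"]
        emeasure_density_const[of A N "ennreal (1 / m)"]
      by simp
    then show ?thesis
      using m by (intro measure_eqI) (auto simp: ennreal_mult_cancel_left)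
  qed
qed

text \<open>Weighting by \<open>1 + Re f\<close> replaces a complex weight \<open>f\<close> by a measure.\<close>

definition tilted_law :: "'a measure \<Rightarrow> ('a \<Rightarrow> complex) \<Rightarrow> ('a \<Rightarrow> real) \<Rightarrow> real measure" where
  "tilted_law M f X = distr (density M (\<lambda>\<omega>. ennreal (1 + Re (f \<omega>)))) borel X"

lemma sets_tilted_law [simp]: "sets (tilted_law M f X) = sets borel"
  by (simp add: tilted_law_def)

lemma integral_tilted_law:
  fixes h :: "real \<Rightarrow> 'b::{banach, second_countable_topology}"
  assumes [measurable]: "f \<in> borel_measurable M" "X \<in> borel_measurable M" "h \<in> borel_measurable borel"
    and f: "\<And>\<omega>. norm (f \<omega>) \<le> 1"
  shows "(\<integral>x. h x \<partial>tilted_law M f X) = (\<integral>\<omega>. (1 + Re (f \<omega>)) *\<^sub>R h (X \<omega>) \<partial>M)"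
proof -
  have "0 \<le> 1 + Re (f \<omega>)" for \<omega> using abs_Re_le_cmod[of "f \<omega>"] f[of \<omega>] by linarith
  then have "(\<integral>\<omega>. h (X \<omega>) \<partial>density M (\<lambda>\<omega>. ennreal (1 + Re (f \<omega>))))
      = (\<integral>\<omega>. (1 + Re (f \<omega>)) *\<^sub>R h (X \<omega>) \<partial>M)"
    by (intro integral_density) auto
  then show ?thesis unfolding tilted_law_def by (subst integral_distr) auto
qed

context finite_measure
begin

lemma finite_measure_tilted_law:
  assumes [measurable]: "f \<in> borel_measurable M" "X \<in> borel_measurable M" and f: "\<And>\<omega>. norm (f \<omega>) \<le> 1"
  shows "finite_measure (tilted_law M f X)"
proof -
  let ?w = "\<lambda>\<omega>. 1 + Re (f \<omega>)"
  have w: "0 \<le> ?w \<omega>" "norm (?w \<omega>) \<le> 2" for \<omega>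
    using abs_Re_le_cmod[of "f \<omega>"] f[of \<omega>] by (auto simp: abs_le_iff)
  have "integrable M ?w" using w(2) by (intro integrable_norm_le) auto
  then have "emeasure (density M (\<lambda>\<omega>. ennreal (?w \<omega>))) (space M) < \<infinity>"
    using w(1) by (simp add: emeasure_density nn_integral_eq_integral cong: nn_integral_cong)
  then interpret P: finite_measure "density M (\<lambda>\<omega>. ennreal (?w \<omega>))" by (intro finite_measureI) simp
  show ?thesis unfolding tilted_law_def by (rule P.finite_measure_distr) simp
qed

lemma char_tilted_law:
  assumes [measurable]: "f \<in> borel_measurable M" "X \<in> borel_measurable M" and f: "\<And>\<omega>. norm (f \<omega>) \<le> 1"
  shows "char (tilted_law M f X) s = (\<integral>\<omega>. iexp (s * X \<omega>) \<partial>M)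
      + ((\<integral>\<omega>. f \<omega> * iexp (s * X \<omega>) \<partial>M) + cnj (\<integral>\<omega>. f \<omega> * iexp (- (s * X \<omega>)) \<partial>M)) / 2"
proof -
  have integrable: "integrable M (\<lambda>\<omega>. iexp (s * X \<omega>))"
    "integrable M (\<lambda>\<omega>. f \<omega> * iexp (s * X \<omega>))" "integrable M (\<lambda>\<omega>. f \<omega> * iexp (- (s * X \<omega>)))"
    using f
    by (auto intro!: integrable_norm_le[where c = 1] simp: norm_mult
        simp del: of_real_mult of_real_minus)
  have "(1 + Re (f \<omega>)) *\<^sub>R iexp (s * X \<omega>)
      = iexp (s * X \<omega>) + (f \<omega> * iexp (s * X \<omega>) + cnj (f \<omega> * iexp (- (s * X \<omega>)))) / 2" for \<omega>
  proof -
    have "complex_of_real (1 + Re (f \<omega>)) = 1 + (f \<omega> + cnj (f \<omega>)) / 2" by (simp add: complex_eq_iff)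
    moreover have "cnj (iexp (- (s * X \<omega>))) = iexp (s * X \<omega>)" by (simp add: exp_cnj)
    ultimately show ?thesis
      by (simp only: scaleR_conv_of_real complex_cnj_mult distrib_right add_divide_distrib mult_1
          times_divide_eq_left)
  qed
  then have "char (tilted_law M f X) s
      = (\<integral>\<omega>. iexp (s * X \<omega>) + (f \<omega> * iexp (s * X \<omega>) + cnj (f \<omega> * iexp (- (s * X \<omega>)))) / 2 \<partial>M)"
    unfolding char_def using f by (subst integral_tilted_law) auto
  then show ?thesis using integrable by (simp del: of_real_mult of_real_minus complex_cnj_mult)
qed

lemma measure_tilted_law:
  assumes [measurable]: "f \<in> borel_measurable M" "X \<in> borel_measurable M" "A \<in> sets borel"
    and f: "\<And>\<omega>. norm (f \<omega>) \<le> 1"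
  shows "measure (tilted_law M f X) A =
      (\<integral>\<omega>. indicator A (X \<omega>) \<partial>M) + Re (\<integral>\<omega>. f \<omega> * indicator A (X \<omega>) \<partial>M)"
proof -
  have "integrable M (\<lambda>\<omega>. indicator A (X \<omega>) :: real)" "integrable M (\<lambda>\<omega>. f \<omega> * indicator A (X \<omega>))"
    using f by (auto intro!: integrable_norm_le[where c = 1] simp: norm_mult indicator_def)
  moreover have "measure (tilted_law M f X) A
      = (\<integral>\<omega>. indicator A (X \<omega>) + Re (f \<omega> * indicator A (X \<omega>)) \<partial>M)"
  proof -
    have "measure (tilted_law M f X) A = (\<integral>x. indicator A x \<partial>tilted_law M f X)" using assms(3) by simp
    also have "\<dots> = (\<integral>\<omega>. (1 + Re (f \<omega>)) *\<^sub>R indicator A (X \<omega>) \<partial>M)"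
      using f by (intro integral_tilted_law) auto
    also have "\<dots> = (\<integral>\<omega>. indicator A (X \<omega>) + Re (f \<omega> * indicator A (X \<omega>)) \<partial>M)"
      by (intro Bochner_Integration.integral_cong) (auto simp: indicator_def)
    finally show ?thesis .
  qed
  ultimately show ?thesis by (simp del: times_complex.simps)
qed

end

lemma weighted_integral_indicator_eqI_char:
  fixes f :: "'a \<Rightarrow> complex" and g :: "'b \<Rightarrow> complex"
  assumes "finite_measure M" "finite_measure N"
    and meas: "f \<in> borel_measurable M" "X \<in> borel_measurable M"
      "g \<in> borel_measurable N" "Y \<in> borel_measurable N"
    and bound: "\<And>\<omega>. norm (f \<omega>) \<le> 1" "\<And>\<omega>. norm (g \<omega>) \<le> 1"
    and char: "\<And>s. (\<integral>\<omega>. iexp (s * X \<omega>) \<partial>M) = (\<integral>\<omega>. iexp (s * Y \<omega>) \<partial>N)"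
    and weighted: "\<And>s. (\<integral>\<omega>. f \<omega> * iexp (s * X \<omega>) \<partial>M) = (\<integral>\<omega>. g \<omega> * iexp (s * Y \<omega>) \<partial>N)"
    and A: "A \<in> sets borel"
  shows "(\<integral>\<omega>. f \<omega> * indicator A (X \<omega>) \<partial>M) = (\<integral>\<omega>. g \<omega> * indicator A (Y \<omega>) \<partial>N)"
proof -
  interpret M: finite_measure M by fact
  interpret N: finite_measure N by fact
  note [measurable] = meas
  let ?p = "\<integral>\<omega>. indicator A (X \<omega>) \<partial>M :: real" and ?q = "\<integral>\<omega>. indicator A (Y \<omega>) \<partial>N :: real"
  let ?F = "\<integral>\<omega>. f \<omega> * indicator A (X \<omega>) \<partial>M" and ?G = "\<integral>\<omega>. g \<omega> * indicator A (Y \<omega>) \<partial>N"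
  have weighted_neg: "(\<integral>\<omega>. f \<omega> * iexp (- (s * X \<omega>)) \<partial>M) = (\<integral>\<omega>. g \<omega> * iexp (- (s * Y \<omega>)) \<partial>N)" for s
    using weighted[of "- s"] by (simp only: mult_minus_left)
  have tilt: "?p + Re (c * ?F) = ?q + Re (c * ?G)" if c: "norm c = 1" for c
  proof -
    have cf: "norm (c * f \<omega>) \<le> 1" and cg: "norm (c * g \<omega>') \<le> 1" for \<omega> \<omega>'
      using bound c by (simp_all add: norm_mult)
    have "tilted_law M (\<lambda>\<omega>. c * f \<omega>) X = tilted_law N (\<lambda>\<omega>. c * g \<omega>) Y"
    proof (rule finite_measure_eqI_char)
      show "char (tilted_law M (\<lambda>\<omega>. c * f \<omega>) X) = char (tilted_law N (\<lambda>\<omega>. c * g \<omega>) Y)"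
        using cf cg
        by (intro ext)
          (simp add: M.char_tilted_law N.char_tilted_law mult.assoc char weighted weighted_neg
            del: of_real_mult of_real_minus)
    qed (use cf cg in \<open>auto intro: M.finite_measure_tilted_law N.finite_measure_tilted_law\<close>)
    then have "measure (tilted_law M (\<lambda>\<omega>. c * f \<omega>) X) A = measure (tilted_law N (\<lambda>\<omega>. c * g \<omega>) Y) A"
      by simp
    then show ?thesis
      using cf cg A by (simp add: M.measure_tilted_law N.measure_tilted_law mult.assoc)
  qed
  have "Re ?F = Re ?G" using tilt[of 1] tilt[of "-1"] by simp
  moreover have "Im ?F = Im ?G" using tilt[of \<i>] tilt[of "- \<i>"] by simp
  ultimately show ?thesis by (rule complex_eqI)
qed

lemma integral_iexp_restrict_space_eqI:
  fixes X U :: "'a \<Rightarrow> real" and Y V :: "'b \<Rightarrow> real"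
  assumes "finite_measure M" "finite_measure N"
    and [measurable]: "X \<in> borel_measurable M" "U \<in> borel_measurable M"
      "Y \<in> borel_measurable N" "V \<in> borel_measurable N"
    and char: "\<And>s. (\<integral>\<omega>. iexp (s * X \<omega>) \<partial>M) = (\<integral>\<omega>. iexp (s * Y \<omega>) \<partial>N)"
    and joint_char: "\<And>s. (\<integral>\<omega>. iexp (s * X \<omega> + U \<omega>) \<partial>M) = (\<integral>\<omega>. iexp (s * Y \<omega> + V \<omega>) \<partial>N)"
    and [measurable]: "A \<in> sets borel"
  shows "(\<integral>\<omega>. iexp (U \<omega>) \<partial>restrict_space M {\<omega> \<in> space M. X \<omega> \<in> A})
    = (\<integral>\<omega>. iexp (V \<omega>) \<partial>restrict_space N {\<omega> \<in> space N. Y \<omega> \<in> A})"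
proof -
  have restrict: "(\<integral>\<omega>. iexp (u \<omega>) \<partial>restrict_space P {\<omega> \<in> space P. x \<omega> \<in> A})
      = (\<integral>\<omega>. iexp (u \<omega>) * indicator A (x \<omega>) \<partial>P)"
    if [measurable]: "x \<in> borel_measurable P" for P :: "'c measure" and x u :: "'c \<Rightarrow> real"
    by (subst integral_restrict_space)
      (auto simp: indicator_def intro!: Bochner_Integration.integral_cong)
  have "(\<integral>\<omega>. iexp (U \<omega>) * indicator A (X \<omega>) \<partial>M) = (\<integral>\<omega>. iexp (V \<omega>) * indicator A (Y \<omega>) \<partial>N)"
  proof (rule weighted_integral_indicator_eqI_char[OF assms(1,2)])
    show "(\<integral>\<omega>. iexp (U \<omega>) * iexp (s * X \<omega>) \<partial>M) = (\<integral>\<omega>. iexp (V \<omega>) * iexp (s * Y \<omega>) \<partial>N)" for s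
      using joint_char[of s] by (simp add: exp_add distrib_left mult.commute)
  qed (use char in auto)
  then show ?thesis by (simp only: restrict assms(3,5))
qed

lemma rectangle_measure_eqI_char:
  fixes X :: "'i \<Rightarrow> 'a \<Rightarrow> real" and Y :: "'i \<Rightarrow> 'b \<Rightarrow> real"
  assumes "finite I" "finite_measure M" "finite_measure N"
    and "\<And>i. X i \<in> borel_measurable M" "\<And>i. Y i \<in> borel_measurable N"
    and "\<And>t. (\<integral>\<omega>. iexp (\<Sum>i\<in>I. t i * X i \<omega>) \<partial>M) = (\<integral>\<omega>. iexp (\<Sum>i\<in>I. t i * Y i \<omega>) \<partial>N)"
    and "\<And>i. i \<in> I \<Longrightarrow> A i \<in> sets borel"
  shows "measure M {\<omega> \<in> space M. \<forall>i\<in>I. X i \<omega> \<in> A i} = measure N {\<omega> \<in> space N. \<forall>i\<in>I. Y i \<omega> \<in> A i}"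
  using assms
proof (induction I arbitrary: M N rule: finite_induct)
  case empty
  then show ?case by simp
next
  case (insert j I)
  note [measurable] = insert.prems(3,4)
  have [measurable]: "A j \<in> sets borel" by (simp add: insert.prems(6))
  define S T where "S = {\<omega> \<in> space M. X j \<omega> \<in> A j}" and "T = {\<omega> \<in> space N. Y j \<omega> \<in> A j}"
  have [measurable]: "S \<in> sets M" "T \<in> sets N" by (auto simp: S_def T_def)
  have char: "(\<integral>\<omega>. iexp (s * X j \<omega> + (\<Sum>i\<in>I. t i * X i \<omega>)) \<partial>M)
      = (\<integral>\<omega>. iexp (s * Y j \<omega> + (\<Sum>i\<in>I. t i * Y i \<omega>)) \<partial>N)" for s t
  proof -
    have "(\<Sum>i\<in>I. (t(j := s)) i * v i) = (\<Sum>i\<in>I. t i * v i)" for v :: "'i \<Rightarrow> real"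
      using insert.hyps by (intro sum.cong) auto
    then show ?thesis using insert.prems(5)[of "t(j := s)"] insert.hyps by simp
  qed
  have "measure (restrict_space M S) {\<omega> \<in> space (restrict_space M S). \<forall>i\<in>I. X i \<omega> \<in> A i}
      = measure (restrict_space N T) {\<omega> \<in> space (restrict_space N T). \<forall>i\<in>I. Y i \<omega> \<in> A i}"
  proof (rule insert.IH)
    show "(\<integral>\<omega>. iexp (\<Sum>i\<in>I. t i * X i \<omega>) \<partial>restrict_space M S)
        = (\<integral>\<omega>. iexp (\<Sum>i\<in>I. t i * Y i \<omega>) \<partial>restrict_space N T)" for t
      unfolding S_def T_def using char[of _ "\<lambda>_. 0"]
      by (intro integral_iexp_restrict_space_eqI insert.prems(1,2) char) auto
  qed (auto intro!: finite_measure_restrict_space insert.prems(1,2,6) measurable_restrict_space1)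
  moreover have "{\<omega> \<in> space (restrict_space M S). \<forall>i\<in>I. X i \<omega> \<in> A i}
      = {\<omega> \<in> space M. \<forall>i\<in>insert j I. X i \<omega> \<in> A i}"
    "{\<omega> \<in> space (restrict_space N T). \<forall>i\<in>I. Y i \<omega> \<in> A i} = {\<omega> \<in> space N. \<forall>i\<in>insert j I. Y i \<omega> \<in> A i}"
    by (auto simp: space_restrict_space S_def T_def)
  ultimately show ?case
    by (simp add: measure_restrict_space S_def T_def subset_eq)
qed

lemma distr_PiM_eqI_char:
  fixes X :: "'i \<Rightarrow> 'a \<Rightarrow> real" and Y :: "'i \<Rightarrow> 'b \<Rightarrow> real"
  assumes "finite I" "finite_measure M" "finite_measure N"
    and [measurable]: "\<And>i. X i \<in> borel_measurable M" "\<And>i. Y i \<in> borel_measurable N"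
    and "\<And>t. (\<integral>\<omega>. iexp (\<Sum>i\<in>I. t i * X i \<omega>) \<partial>M) = (\<integral>\<omega>. iexp (\<Sum>i\<in>I. t i * Y i \<omega>) \<partial>N)"
  shows "distr M (\<Pi>\<^sub>M i\<in>I. borel) (\<lambda>\<omega>. \<lambda>i\<in>I. X i \<omega>) = distr N (\<Pi>\<^sub>M i\<in>I. borel) (\<lambda>\<omega>. \<lambda>i\<in>I. Y i \<omega>)"
proof (rule measure_eqI_PiM_finite[OF \<open>finite I\<close>])
  interpret M: finite_measure M by fact
  interpret N: finite_measure N by fact
  let ?X = "\<lambda>\<omega>. \<lambda>i\<in>I. X i \<omega>" and ?Y = "\<lambda>\<omega>. \<lambda>i\<in>I. Y i \<omega>"
  fix A :: "'i \<Rightarrow> real set" assume A: "\<And>i. i \<in> I \<Longrightarrow> A i \<in> sets borel"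
  then have rect [measurable]: "Pi\<^sub>E I A \<in> sets (\<Pi>\<^sub>M i\<in>I. borel)"
    using \<open>finite I\<close> by (intro sets_PiM_I_finite) auto
  have "?X -` Pi\<^sub>E I A \<inter> space M = {\<omega> \<in> space M. \<forall>i\<in>I. X i \<omega> \<in> A i}"
    "?Y -` Pi\<^sub>E I A \<inter> space N = {\<omega> \<in> space N. \<forall>i\<in>I. Y i \<omega> \<in> A i}" by auto
  then show "emeasure (distr M (\<Pi>\<^sub>M i\<in>I. borel) ?X) (Pi\<^sub>E I A)
      = emeasure (distr N (\<Pi>\<^sub>M i\<in>I. borel) ?Y) (Pi\<^sub>E I A)"
    using rectangle_measure_eqI_char[OF assms A]
    by (simp add: emeasure_distr M.emeasure_eq_measure N.emeasure_eq_measure)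
next
  show "range (\<lambda>_::nat. \<Pi>\<^sub>E i\<in>I. UNIV) \<subseteq> prod_algebra I (\<lambda>_. borel :: real measure)"
    using \<open>finite I\<close> by (auto intro!: prod_algebraI_finite)
  interpret finite_measure "distr M (\<Pi>\<^sub>M i\<in>I. borel) (\<lambda>\<omega>. \<lambda>i\<in>I. X i \<omega>)"
    by (rule finite_measure.finite_measure_distr[OF assms(2)]) simp
  show "emeasure (distr M (\<Pi>\<^sub>M i\<in>I. borel) (\<lambda>\<omega>. \<lambda>i\<in>I. X i \<omega>)) (\<Pi>\<^sub>E i\<in>I. UNIV) \<noteq> \<infinity>"
    by simp
qed (simp_all add: space_PiM)

subsection \<open>Positively related events\<close>

lemma measurable_function_of_satisfied:
  fixes g :: "'i set \<Rightarrow> real"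
  assumes "finite D" and P: "\<And>y. y \<in> D \<Longrightarrow> Measurable.pred M (P y)"
  shows "(\<lambda>\<omega>. g {y \<in> D. P y \<omega>}) \<in> borel_measurable M"
proof -
  have "(\<lambda>\<omega>. {y \<in> D. P y \<omega>}) -` {S} \<inter> space M \<in> sets M" if "S \<in> Pow D" for S
  proof -
    have "(\<lambda>\<omega>. {y \<in> D. P y \<omega>}) -` {S} \<inter> space M = {\<omega> \<in> space M. \<forall>y\<in>D. P y \<omega> \<longleftrightarrow> y \<in> S}"
      using that by auto
    also have "\<dots> \<in> sets M"
      using P by (intro sets.sets_Collect_finite_All \<open>finite D\<close>) (auto simp: pred_def)
    finally show ?thesis .
  qed
  then have "(\<lambda>\<omega>. {y \<in> D. P y \<omega>}) \<in> measurable M (count_space (Pow D))"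
    using \<open>finite D\<close> by (intro measurable_count_space_eq2[THEN iffD2]) auto
  then show ?thesis by (rule measurable_compose) simp
qed

lemma abs_function_of_subset_le:
  fixes g :: "'i set \<Rightarrow> real"
  assumes "finite D"
  shows "\<bar>g {y \<in> D. P y}\<bar> \<le> (\<Sum>S\<in>Pow D. \<bar>g S\<bar>)"
  using assms by (intro member_le_sum[of _ _ "\<lambda>S. \<bar>g S\<bar>"]) auto

lemma (in finite_measure) integrable_function_of_satisfied:
  fixes g :: "'i set \<Rightarrow> real"
  assumes "finite D" and "\<And>y. y \<in> D \<Longrightarrow> Measurable.pred M (P y)"
  shows "integrable M (\<lambda>\<omega>. g {y \<in> D. P y \<omega>})"
proof (rule integrable_norm_le[OF measurable_function_of_satisfied[OF assms]])
  show "norm (g {y \<in> D. P y \<omega>}) \<le> (\<Sum>S\<in>Pow D. \<bar>g S\<bar>)" for \<omega>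
    using abs_function_of_subset_le[OF assms(1)] by simp
qed

definition bernoulli_weight :: "('i \<Rightarrow> real) \<Rightarrow> 'i set \<Rightarrow> 'i set \<Rightarrow> real" where
  "bernoulli_weight p D S = (\<Prod>x\<in>S. p x) * (\<Prod>x\<in>D - S. 1 - p x)"

lemma sum_bernoulli_weight_insert:
  assumes "finite D" and "x \<notin> D"
  shows "(\<Sum>S\<in>Pow (insert x D). h S * bernoulli_weight p (insert x D) S)
    = (\<Sum>S\<in>Pow D. (p x * h (insert x S) + (1 - p x) * h S) * bernoulli_weight p D S)"
proof -
  have weights: "bernoulli_weight p (insert x D) S = (1 - p x) * bernoulli_weight p D S"
    "bernoulli_weight p (insert x D) (insert x S) = p x * bernoulli_weight p D S" if "S \<in> Pow D" for S
  proof -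
    have "finite S" "x \<notin> S" using that assms finite_subset by auto
    moreover from this have "insert x D - S = insert x (D - S)" "insert x D - insert x S = D - S"
      using assms by auto
    ultimately show "bernoulli_weight p (insert x D) S = (1 - p x) * bernoulli_weight p D S"
      "bernoulli_weight p (insert x D) (insert x S) = p x * bernoulli_weight p D S"
      using assms by (simp_all add: bernoulli_weight_def)
  qed
  have "inj_on (insert x) (Pow D)" using assms by (auto simp: inj_on_def)
  then have "(\<Sum>S\<in>Pow (insert x D). h S * bernoulli_weight p (insert x D) S)
      = (\<Sum>S\<in>Pow D. h S * bernoulli_weight p (insert x D) S)
        + (\<Sum>S\<in>Pow D. h (insert x S) * bernoulli_weight p (insert x D) (insert x S))"
    unfolding Pow_insert using assms by (subst sum.union_disjoint) (auto simp: sum.reindex)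
  also have "\<dots> = (\<Sum>S\<in>Pow D. (p x * h (insert x S) + (1 - p x) * h S) * bernoulli_weight p D S)"
    by (simp add: weights sum.distrib[symmetric] algebra_simps)
  finally show ?thesis .
qed

definition (in prob_space) event_cov :: "'a set \<Rightarrow> 'a set \<Rightarrow> real" where
  "event_cov A B = prob (A \<inter> B) - prob A * prob B"

lemma (in prob_space) integral_centred_indicator:
  assumes [measurable]: "A \<in> events" "B \<in> events"
  shows "(\<integral>\<omega>. (indicator A \<omega> - prob A) * indicator B \<omega> \<partial>M) = event_cov A B"
proof -
  have "(\<integral>\<omega>. (indicator A \<omega> - prob A) * indicator B \<omega> \<partial>M)
      = (\<integral>\<omega>. indicator (A \<inter> B) \<omega> - prob A * indicator B \<omega> \<partial>M)"
    by (simp add: indicator_inter_arith left_diff_distrib)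
  also have "\<dots> = event_cov A B" by (simp add: event_cov_def emeasure_eq_measure)
  finally show ?thesis .
qed

lemma mono_on_card_add_bounded:
  fixes g :: "'i set \<Rightarrow> real"
  assumes "finite D" and g: "\<And>S. \<bar>g S\<bar> \<le> 1"
  shows "mono_on \<F> (\<lambda>S. 2 * real (card (S \<inter> D)) + g (S \<inter> D))"
proof (rule mono_onI)
  fix S T :: "'i set" assume "S \<subseteq> T"
  show "2 * real (card (S \<inter> D)) + g (S \<inter> D) \<le> 2 * real (card (T \<inter> D)) + g (T \<inter> D)"
  proof (cases "S \<inter> D = T \<inter> D")
    case False
    then have "S \<inter> D \<subset> T \<inter> D" using \<open>S \<subseteq> T\<close> by blast
    then have "card (S \<inter> D) < card (T \<inter> D)" using assms(1) by (intro psubset_card_mono) auto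
    then have "real (card (S \<inter> D)) + 1 \<le> real (card (T \<inter> D))" by linarith
    then show ?thesis using g[of "S \<inter> D"] g[of "T \<inter> D"] by linarith
  qed simp
qed

locale positively_related_events = prob_space M for M :: "'a measure" +
  fixes B :: "'i set" and E :: "'i \<Rightarrow> 'a set"
  assumes finite_B: "finite B"
    and events: "\<And>x. x \<in> B \<Longrightarrow> E x \<in> events"
    and positively_related: "\<And>x G. x \<in> B \<Longrightarrow> mono_on (Pow B) G \<Longrightarrow>
      0 \<le> (\<integral>\<omega>. (indicator (E x) \<omega> - prob (E x)) * G {y \<in> B. \<omega> \<in> E y} \<partial>M)"
begin

abbreviation occurring :: "'i set \<Rightarrow> 'a \<Rightarrow> 'i set" where
  "occurring D \<omega> \<equiv> {y \<in> D. \<omega> \<in> E y}"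

lemma integrable_centred_indicator_mult:
  assumes "x \<in> B" "D \<subseteq> B"
  shows "integrable M (\<lambda>\<omega>. (indicator (E x) \<omega> - prob (E x)) * g (occurring D \<omega>))"
proof -
  have "finite D" using assms finite_B finite_subset by blast
  then have "integrable M (\<lambda>\<omega>. g (occurring D \<omega>))"
    using assms events by (intro integrable_function_of_satisfied) auto
  then have "integrable M (\<lambda>\<omega>. indicator (E x) \<omega> *\<^sub>R g (occurring D \<omega>)
      - prob (E x) * g (occurring D \<omega>))"
    using events[OF assms(1)]
    by (intro Bochner_Integration.integrable_diff integrable_mult_indicator) auto
  then show ?thesis by (simp add: left_diff_distrib)
qed

lemma abs_integral_centred_indicator_le:
  assumes x: "x \<in> B" and D: "D \<subseteq> B" and g: "\<And>S. \<bar>g S\<bar> \<le> 1"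
  shows "\<bar>\<integral>\<omega>. (indicator (E x) \<omega> - prob (E x)) * g (occurring D \<omega>) \<partial>M\<bar>
    \<le> 2 * (\<Sum>y\<in>D. event_cov (E x) (E y))"
proof -
  define Z where "Z = (\<lambda>\<omega>. indicator (E x) \<omega> - prob (E x))"
  have finD: "finite D" using D finite_B finite_subset by blast
  have E [measurable]: "E x \<in> events" "y \<in> D \<Longrightarrow> E y \<in> events" for y using x D events by auto
  have integrable_g: "integrable M (\<lambda>\<omega>. Z \<omega> * g (occurring D \<omega>))"
    unfolding Z_def by (rule integrable_centred_indicator_mult[OF x D])
  have integrable_indicator: "integrable M (\<lambda>\<omega>. Z \<omega> * indicator (E y) \<omega>)" if "y \<in> D" for y
    unfolding Z_def using E(1) E(2)[OF that]
    by (simp add: left_diff_distrib emeasure_eq_measure flip: indicator_inter_arith)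
  have "0 \<le> 2 * (\<Sum>y\<in>D. event_cov (E x) (E y)) + r * (\<integral>\<omega>. Z \<omega> * g (occurring D \<omega>) \<partial>M)"
    if r: "\<bar>r\<bar> = 1" for r :: real
  proof -
    define G where "G = (\<lambda>S. 2 * real (card (S \<inter> D)) + r * g (S \<inter> D))"
    have "mono_on (Pow B) G"
      unfolding G_def using finD g r by (intro mono_on_card_add_bounded) (simp_all add: abs_mult)
    then have "0 \<le> (\<integral>\<omega>. Z \<omega> * G (occurring B \<omega>) \<partial>M)"
      unfolding Z_def by (rule positively_related[OF x])
    also have "\<dots> = (\<integral>\<omega>. 2 * (\<Sum>y\<in>D. Z \<omega> * indicator (E y) \<omega>) + r * (Z \<omega> * g (occurring D \<omega>)) \<partial>M)"
    proof (intro Bochner_Integration.integral_cong refl)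
      fix \<omega>
      have "occurring B \<omega> \<inter> D = occurring D \<omega>" using D by auto
      moreover have "real (card (occurring D \<omega>)) = (\<Sum>y\<in>D. indicator (E y) \<omega>)"
        using finD by (simp add: indicator_def of_bool_def sum.If_cases Int_def)
      ultimately show "Z \<omega> * G (occurring B \<omega>)
          = 2 * (\<Sum>y\<in>D. Z \<omega> * indicator (E y) \<omega>) + r * (Z \<omega> * g (occurring D \<omega>))"
        by (simp add: G_def sum_distrib_left algebra_simps)
    qed
    also have "\<dots> = 2 * (\<Sum>y\<in>D. \<integral>\<omega>. Z \<omega> * indicator (E y) \<omega> \<partial>M) + r * (\<integral>\<omega>. Z \<omega> * g (occurring D \<omega>) \<partial>M)"
      using integrable_g integrable_indicator by simp
    also have "(\<Sum>y\<in>D. \<integral>\<omega>. Z \<omega> * indicator (E y) \<omega> \<partial>M) = (\<Sum>y\<in>D. event_cov (E x) (E y))"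
      unfolding Z_def using E by (intro sum.cong integral_centred_indicator) auto
    finally show ?thesis .
  qed
  from this[of 1] this[of "-1"] show ?thesis by (simp add: Z_def abs_le_iff)
qed

lemma event_cov_nonneg:
  assumes "x \<in> B" "y \<in> B"
  shows "0 \<le> event_cov (E x) (E y)"
  using abs_integral_centred_indicator_le[of x "{y}" "\<lambda>_. 0"] assms by simp

lemma expectation_occurring_insert:
  fixes h :: "'i set \<Rightarrow> real"
  assumes "x \<in> B" "D \<subseteq> B"
  shows "(\<integral>\<omega>. h (occurring (insert x D) \<omega>) \<partial>M)
    = (\<integral>\<omega>. prob (E x) * h (insert x (occurring D \<omega>)) + (1 - prob (E x)) * h (occurring D \<omega>) \<partial>M)
      + (\<integral>\<omega>. (indicator (E x) \<omega> - prob (E x))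
          * (h (insert x (occurring D \<omega>)) - h (occurring D \<omega>)) \<partial>M)"
proof -
  let ?h' = "\<lambda>S. prob (E x) * h (insert x S) + (1 - prob (E x)) * h S"
    and ?g = "\<lambda>S. h (insert x S) - h S"
  have "h (occurring (insert x D) \<omega>)
      = ?h' (occurring D \<omega>) + (indicator (E x) \<omega> - prob (E x)) * ?g (occurring D \<omega>)" for \<omega>
  proof -
    have "occurring (insert x D) \<omega> = (if \<omega> \<in> E x then insert x (occurring D \<omega>) else occurring D \<omega>)"
      by auto
    then show ?thesis by (simp add: algebra_simps)
  qed
  moreover have "integrable M (\<lambda>\<omega>. ?h' (occurring D \<omega>))"
    using assms(2) finite_B events
    by (intro integrable_function_of_satisfied) (auto intro: finite_subset)
  ultimately show ?thesis
    using integrable_centred_indicator_mult[OF assms, of ?g] by simp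
qed

lemma abs_expectation_diff_bernoulli_le:
  assumes "D \<subseteq> B" and "\<And>S. 0 \<le> h S \<and> h S \<le> 1"
  shows "\<bar>(\<integral>\<omega>. h (occurring D \<omega>) \<partial>M) - (\<Sum>S\<in>Pow D. h S * bernoulli_weight (\<lambda>x. prob (E x)) D S)\<bar>
    \<le> 2 * (\<Sum>x\<in>D. \<Sum>y\<in>D - {x}. event_cov (E x) (E y))"
proof -
  have "finite D" using assms(1) finite_B finite_subset by blast
  then show ?thesis using assms
  proof (induction D arbitrary: h rule: finite_induct)
    case empty
    then show ?case by (simp add: prob_space bernoulli_weight_def)
  next
    case (insert x D)
    let ?w = "bernoulli_weight (\<lambda>x. prob (E x))"
    define h' where "h' = (\<lambda>S. prob (E x) * h (insert x S) + (1 - prob (E x)) * h S)"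
    define g where "g = (\<lambda>S. h (insert x S) - h S)"
    have xB: "x \<in> B" and DB: "D \<subseteq> B" using insert.prems by auto
    have "0 \<le> h' S \<and> h' S \<le> 1" for S
      using insert.prems(2) convex_bound_le[of "h (insert x S)" 1 "h S" "prob (E x)" "1 - prob (E x)"]
      by (auto simp: h'_def)
    then have rest: "\<bar>(\<integral>\<omega>. h' (occurring D \<omega>) \<partial>M) - (\<Sum>S\<in>Pow D. h' S * ?w D S)\<bar>
        \<le> 2 * (\<Sum>x\<in>D. \<Sum>y\<in>D - {x}. event_cov (E x) (E y))"
      by (rule insert.IH[OF DB])
    have "\<bar>g S\<bar> \<le> 1" for S
      using insert.prems(2)[of S] insert.prems(2)[of "insert x S"] by (auto simp: g_def)
    then have replace: "\<bar>\<integral>\<omega>. (indicator (E x) \<omega> - prob (E x)) * g (occurring D \<omega>) \<partial>M\<bar>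
        \<le> 2 * (\<Sum>y\<in>D. event_cov (E x) (E y))"
      by (rule abs_integral_centred_indicator_le[OF xB DB])
    have expectation: "(\<integral>\<omega>. h (occurring (insert x D) \<omega>) \<partial>M)
        = (\<integral>\<omega>. h' (occurring D \<omega>) \<partial>M)
          + (\<integral>\<omega>. (indicator (E x) \<omega> - prob (E x)) * g (occurring D \<omega>) \<partial>M)"
      unfolding h'_def g_def by (rule expectation_occurring_insert[OF xB DB])
    have weights: "(\<Sum>S\<in>Pow (insert x D). h S * ?w (insert x D) S) = (\<Sum>S\<in>Pow D. h' S * ?w D S)"
      using insert.hyps by (simp add: sum_bernoulli_weight_insert h'_def)
    have "(\<Sum>a\<in>D. \<Sum>y\<in>D - {a}. event_cov (E a) (E y))
        \<le> (\<Sum>a\<in>D. \<Sum>y\<in>insert x D - {a}. event_cov (E a) (E y))"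
      using insert.hyps DB xB by (intro sum_mono sum_mono2 event_cov_nonneg) auto
    moreover have "insert x D - {x} = D" using insert.hyps by auto
    ultimately have "(\<Sum>y\<in>D. event_cov (E x) (E y)) + (\<Sum>a\<in>D. \<Sum>y\<in>D - {a}. event_cov (E a) (E y))
        \<le> (\<Sum>a\<in>insert x D. \<Sum>y\<in>insert x D - {a}. event_cov (E a) (E y))"
      using insert.hyps by simp
    then show ?case
      using rest replace unfolding expectation weights by linarith
  qed
qed

lemma abs_prob_occurring_diff_bernoulli_le:
  assumes D: "D \<subseteq> B"
  shows "\<bar>prob {\<omega> \<in> space M. occurring D \<omega> \<in> \<A>}
      - (\<Sum>S\<in>\<A> \<inter> Pow D. bernoulli_weight (\<lambda>x. prob (E x)) D S)\<bar>
    \<le> 2 * (\<Sum>x\<in>D. \<Sum>y\<in>D - {x}. event_cov (E x) (E y))"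
proof -
  have finD: "finite D" using D finite_B finite_subset by blast
  have "(\<lambda>\<omega>. indicator \<A> (occurring D \<omega>) :: real) \<in> borel_measurable M"
    using finD D events by (intro measurable_function_of_satisfied) auto
  then have "(\<lambda>\<omega>. indicator \<A> (occurring D \<omega>) :: real) -` {1} \<inter> space M \<in> events"
    by (rule measurable_sets) simp
  then have "{\<omega> \<in> space M. occurring D \<omega> \<in> \<A>} \<in> events"
    by (simp add: indicator_def vimage_def Int_def conj_commute)
  then have "prob {\<omega> \<in> space M. occurring D \<omega> \<in> \<A>}
      = (\<integral>\<omega>. indicator {\<omega> \<in> space M. occurring D \<omega> \<in> \<A>} \<omega> \<partial>M)"
    by simp
  also have "\<dots> = (\<integral>\<omega>. indicator \<A> (occurring D \<omega>) \<partial>M)"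
    by (intro Bochner_Integration.integral_cong) (auto simp: indicator_def)
  finally have prob_eq: "prob {\<omega> \<in> space M. occurring D \<omega> \<in> \<A>} = \<dots>" .
  have "(\<Sum>S\<in>\<A> \<inter> Pow D. bernoulli_weight (\<lambda>x. prob (E x)) D S)
      = (\<Sum>S\<in>Pow D. indicator \<A> S * bernoulli_weight (\<lambda>x. prob (E x)) D S)"
    using finD by (intro sum.mono_neutral_cong_left) (auto simp: indicator_def)
  then show ?thesis
    unfolding prob_eq using abs_expectation_diff_bernoulli_le[OF D, of "indicator \<A>"] by simp
qed

end

context prob_space
begin

lemma prob_Collect_eq_integral:
  fixes f :: "'a \<Rightarrow> real"
  assumes [measurable]: "Measurable.pred M P" and f: "\<And>\<omega>. f \<omega> = of_bool (P \<omega>)"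
  shows "prob {\<omega> \<in> space M. P \<omega>} = (\<integral>\<omega>. f \<omega> \<partial>M)"
proof -
  have "prob {\<omega> \<in> space M. P \<omega>} = (\<integral>\<omega>. indicator {\<omega> \<in> space M. P \<omega>} \<omega> \<partial>M)" by simp
  also have "\<dots> = (\<integral>\<omega>. f \<omega> \<partial>M)"
    by (intro Bochner_Integration.integral_cong) (auto simp: f indicator_def)
  finally show ?thesis .
qed

text \<open>The centred indicator has mean \<open>0\<close> and the sign of \<open>k (X \<omega>) - k u\<close>.\<close>

lemma integral_centred_mult_mono_nonneg:
  fixes X :: "'a \<Rightarrow> real" and k :: "real \<Rightarrow> real"
  assumes X [measurable]: "X \<in> borel_measurable M" and "mono k" and k_bound: "\<And>s. \<bar>k s\<bar> \<le> c"
    and [measurable]: "(\<lambda>\<omega>. k (X \<omega>)) \<in> borel_measurable M"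
  shows "0 \<le> (\<integral>\<omega>. (indicator {u..} (X \<omega>) - prob {\<omega> \<in> space M. u \<le> X \<omega>}) * k (X \<omega>) \<partial>M)"
proof -
  define p where "p = prob {\<omega> \<in> space M. u \<le> X \<omega>}"
  define Z where "Z = (\<lambda>\<omega>. indicator {u..} (X \<omega>) - p)"
  have p: "0 \<le> p" "p \<le> 1" by (auto simp: p_def)
  have [measurable]: "Z \<in> borel_measurable M" by (simp add: Z_def)
  have Z_bound: "\<bar>Z \<omega>\<bar> \<le> 1" for \<omega> using p by (auto simp: Z_def indicator_def)
  have indicator: "integrable M (\<lambda>\<omega>. indicator {u..} (X \<omega>) :: real)"
    by (rule integrable_norm_le[where c = 1]) (auto simp: indicator_def)
  have "p = (\<integral>\<omega>. indicator {u..} (X \<omega>) \<partial>M)"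
    unfolding p_def by (rule prob_Collect_eq_integral) (auto simp: indicator_def)
  then have Z: "integrable M Z" "(\<integral>\<omega>. Z \<omega> \<partial>M) = 0"
    using indicator by (simp_all add: Z_def prob_space)
  have "norm (Z \<omega> * k (X \<omega>)) \<le> 1 * c" for \<omega>
    unfolding norm_mult using Z_bound k_bound by (intro mult_mono) auto
  then have "integrable M (\<lambda>\<omega>. Z \<omega> * k (X \<omega>))" by (intro integrable_norm_le) auto
  then have "(\<integral>\<omega>. Z \<omega> * k (X \<omega>) \<partial>M) = (\<integral>\<omega>. Z \<omega> * (k (X \<omega>) - k u) \<partial>M)"
    using Z by (simp add: right_diff_distrib)
  also have "0 \<le> \<dots>"
  proof (rule Bochner_Integration.integral_nonneg)
    show "0 \<le> Z \<omega> * (k (X \<omega>) - k u)" for \<omega>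
      using p monoD[OF \<open>mono k\<close>, of u "X \<omega>"] monoD[OF \<open>mono k\<close>, of "X \<omega>" u]
      by (cases "u \<le> X \<omega>") (auto simp: Z_def mult_nonneg_nonpos)
  qed
  finally show ?thesis by (simp add: Z_def p_def)
qed

end

subsection \<open>Tails of centred Gaussian variables\<close>

definition normal_tail :: "real \<Rightarrow> real" where
  "normal_tail t = measure std_normal_distribution {t..}"

lemma normal_tail_antimono: "s \<le> t \<Longrightarrow> normal_tail t \<le> normal_tail s"
proof -
  interpret prob_space std_normal_distribution by (rule prob_space_normal_density) simp
  show "s \<le> t \<Longrightarrow> normal_tail t \<le> normal_tail s"
    unfolding normal_tail_def by (intro finite_measure_mono) auto
qed

lemma normal_tail_eq_integral:
  "normal_tail t = (\<integral>x. std_normal_density x * indicator {t..} x \<partial>lborel)"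
  "integrable lborel (\<lambda>x. std_normal_density x * indicator {t..} x)"
proof -
  have "normal_tail t = (\<integral>x. indicator {t..} x \<partial>std_normal_distribution)" by (simp add: normal_tail_def)
  also have "\<dots> = (\<integral>x. std_normal_density x * indicator {t..} x \<partial>lborel)"
    by (subst integral_density) auto
  finally show "normal_tail t = (\<integral>x. std_normal_density x * indicator {t..} x \<partial>lborel)" .
  show "integrable lborel (\<lambda>x. std_normal_density x * indicator {t..} x)"
    using integrable_mult_indicator[of "{t..}" lborel std_normal_density] by (simp add: mult.commute)
qed

text \<open>For \<open>0 \<le> t \<le> x\<close> the standard density at \<open>x\<close> is at most \<open>exp (- t\<^sup>2 / 2)\<close> times the normal density
  with mean \<open>t\<close>.\<close>

lemma normal_tail_le_exp:
  assumes "0 \<le> t"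
  shows "normal_tail t \<le> exp (- t\<^sup>2 / 2)"
proof -
  have "normal_tail t \<le> (\<integral>x. exp (- t\<^sup>2 / 2) * normal_density t 1 x \<partial>lborel)"
    unfolding normal_tail_eq_integral(1)
  proof (intro integral_mono normal_tail_eq_integral(2) integrable_mult_right)
    fix x :: real
    show "std_normal_density x * indicator {t..} x \<le> exp (- t\<^sup>2 / 2) * normal_density t 1 x"
    proof (cases "t \<le> x")
      case True
      have "0 \<le> t * (x - t)" using assms True by simp
      then have "- x\<^sup>2 / 2 \<le> - t\<^sup>2 / 2 + - (x - t)\<^sup>2 / 2" by (simp add: power2_eq_square algebra_simps)
      then have "exp (- x\<^sup>2 / 2) \<le> exp (- t\<^sup>2 / 2) * exp (- (x - t)\<^sup>2 / 2)"
        by (simp add: exp_add[symmetric] del: minus_divide_left)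
      then have "exp (- x\<^sup>2 / 2) / sqrt (2 * pi)
          \<le> exp (- t\<^sup>2 / 2) * exp (- (x - t)\<^sup>2 / 2) / sqrt (2 * pi)"
        by (intro divide_right_mono) auto
      then show ?thesis using True by (simp add: normal_density_def)
    qed auto
  qed auto
  then show ?thesis by simp
qed

lemma normal_tail_diff_le:
  assumes "0 \<le> s" "s \<le> t"
  shows "normal_tail s - normal_tail t \<le> (t - s) * exp (- s\<^sup>2 / 2)"
proof -
  have "normal_tail s - normal_tail t
      = (\<integral>x. std_normal_density x * indicator {s..} x - std_normal_density x * indicator {t..} x \<partial>lborel)"
    by (simp add: normal_tail_eq_integral)
  also have "\<dots> \<le> (\<integral>x. exp (- s\<^sup>2 / 2) * indicator {s..t} x \<partial>lborel)"
  proof (intro integral_mono Bochner_Integration.integrable_diff normal_tail_eq_integral(2))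
    show "integrable lborel (\<lambda>x. exp (- s\<^sup>2 / 2) * indicator {s..t} x)"
      using assms by (intro integrable_mult_right integrable_real_indicator) auto
    fix x :: real
    have "std_normal_density x \<le> exp (- s\<^sup>2 / 2)" if "s \<le> x"
    proof -
      have "1 \<le> sqrt (2 * pi)" using pi_ge_two by simp
      then have "std_normal_density x \<le> exp (- x\<^sup>2 / 2)"
        by (simp add: std_normal_density_def divide_le_eq mult_le_cancel_left1)
      also have "\<dots> \<le> exp (- s\<^sup>2 / 2)" using assms that by (simp add: power_mono)
      finally show ?thesis .
    qed
    then show "std_normal_density x * indicator {s..} x - std_normal_density x * indicator {t..} x
        \<le> exp (- s\<^sup>2 / 2) * indicator {s..t} x"
      using assms by (auto simp: indicator_def)
  qed
  also have "\<dots> = (t - s) * exp (- s\<^sup>2 / 2)" using assms by simp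
  finally show ?thesis .
qed

context prob_space
begin

lemma centred_gaussian_standardize:
  assumes "centred_gaussian_rv M X v" and "0 < v"
  shows "distr M lborel (\<lambda>\<omega>. X \<omega> / sqrt v) = std_normal_distribution"
proof -
  have "distributed M lborel X (normal_density 0 (sqrt v))"
    using assms by (auto simp: centred_gaussian_rv_def split: if_splits)
  then have "distributed M lborel (\<lambda>\<omega>. X \<omega> / sqrt v) std_normal_density"
    using normal_standard_normal_convert[of "sqrt v" X 0] assms(2) by simp
  then show ?thesis by (rule distributed_distr_eq_density)
qed

lemma prob_centred_gaussian_ge:
  assumes "centred_gaussian_rv M X v" and "0 < v"
  shows "prob {\<omega> \<in> space M. u \<le> X \<omega>} = normal_tail (u / sqrt v)"
proof -
  have [measurable]: "X \<in> borel_measurable M" using assms by (simp add: centred_gaussian_rv_def)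
  have "normal_tail (u / sqrt v) = measure (distr M lborel (\<lambda>\<omega>. X \<omega> / sqrt v)) {u / sqrt v..}"
    by (simp add: normal_tail_def centred_gaussian_standardize[OF assms])
  also have "\<dots> = prob ((\<lambda>\<omega>. X \<omega> / sqrt v) -` {u / sqrt v..} \<inter> space M)" by (rule measure_distr) auto
  also have "(\<lambda>\<omega>. X \<omega> / sqrt v) -` {u / sqrt v..} \<inter> space M = {\<omega> \<in> space M. u \<le> X \<omega>}"
    using assms(2) by (auto simp: divide_le_cancel)
  finally show ?thesis ..
qed

lemma prob_centred_gaussian_ge_le_exp:
  assumes "centred_gaussian_rv M X v" and "0 < v" "v \<le> V" and "0 \<le> u"
  shows "prob {\<omega> \<in> space M. u \<le> X \<omega>} \<le> exp (- u\<^sup>2 / (2 * V))"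
proof -
  have "prob {\<omega> \<in> space M. u \<le> X \<omega>} \<le> exp (- (u / sqrt v)\<^sup>2 / 2)"
    unfolding prob_centred_gaussian_ge[OF assms(1,2)] using assms by (intro normal_tail_le_exp) auto
  also have "(u / sqrt v)\<^sup>2 = u\<^sup>2 / v" using assms by (simp add: power_divide)
  also have "exp (- (u\<^sup>2 / v) / 2) \<le> exp (- u\<^sup>2 / (2 * V))"
    using assms by (simp add: frac_le)
  finally show ?thesis .
qed

lemma centred_gaussian_char:
  assumes "centred_gaussian_rv M X v"
  shows "(\<integral>\<omega>. iexp (X \<omega>) \<partial>M) = exp (- v / 2)"
proof (cases "v = 0")
  case True
  then have "AE \<omega> in M. X \<omega> = 0" and [measurable]: "X \<in> borel_measurable M"
    using assms by (auto simp: centred_gaussian_rv_def)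
  then have "(\<integral>\<omega>. iexp (X \<omega>) \<partial>M) = (\<integral>\<omega>. 1 \<partial>M)"
    by (intro integral_cong_AE) (auto elim!: eventually_mono)
  then show ?thesis using True by (simp add: prob_space)
next
  case False
  then have v: "0 < v" and [measurable]: "X \<in> borel_measurable M"
    using assms by (auto simp: centred_gaussian_rv_def)
  have "(\<integral>\<omega>. iexp (X \<omega>) \<partial>M) = (\<integral>\<omega>. iexp (sqrt v * (X \<omega> / sqrt v)) \<partial>M)" using v by simp
  also have "\<dots> = (\<integral>x. iexp (sqrt v * x) \<partial>distr M lborel (\<lambda>\<omega>. X \<omega> / sqrt v))"
    by (rule integral_distr[symmetric]) auto
  also have "\<dots> = char std_normal_distribution (sqrt v)"
    by (simp add: char_def centred_gaussian_standardize[OF assms v])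
  also have "\<dots> = exp (- v / 2)" using v by (simp add: char_std_normal_distribution)
  finally show ?thesis .
qed

end

subsection \<open>Gaussian families with nonnegative covariances\<close>

locale gaussian_family = prob_space M for M :: "'a measure" +
  fixes B :: "'i set" and K :: "'i \<Rightarrow> 'i \<Rightarrow> real" and \<phi> :: "'i \<Rightarrow> 'a \<Rightarrow> real"
  assumes finite_B: "finite B"
    and measurable_\<phi> [measurable]: "\<And>x. \<phi> x \<in> borel_measurable M"
    and gaussian: "\<And>c. centred_gaussian_rv M (\<lambda>\<omega>. \<Sum>x\<in>B. c x * \<phi> x \<omega>) (\<Sum>x\<in>B. \<Sum>y\<in>B. c x * c y * K x y)"
    and K_sym: "\<And>x y. x \<in> B \<Longrightarrow> y \<in> B \<Longrightarrow> K x y = K y x"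
    and K_nonneg: "\<And>x y. x \<in> B \<Longrightarrow> y \<in> B \<Longrightarrow> 0 \<le> K x y"
    and K_diag_pos: "\<And>x. x \<in> B \<Longrightarrow> 0 < K x x"
begin

definition slope :: "'i \<Rightarrow> 'i \<Rightarrow> real" where
  "slope x y = K x y / K x x"

definition residual :: "'i \<Rightarrow> 'i \<Rightarrow> 'a \<Rightarrow> real" where
  "residual x y \<omega> = \<phi> y \<omega> - slope x y * \<phi> x \<omega>"

lemma measurable_residual [measurable]: "residual x y \<in> borel_measurable M"
  unfolding residual_def by measurable

lemma slope_nonneg: "x \<in> B \<Longrightarrow> y \<in> B \<Longrightarrow> 0 \<le> slope x y"
  by (simp add: slope_def K_nonneg)

lemma slope_self: "x \<in> B \<Longrightarrow> slope x x = 1"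
  using K_diag_pos[of x] by (simp add: slope_def)

lemma residual_self: "x \<in> B \<Longrightarrow> residual x x \<omega> = 0"
  by (simp add: residual_def slope_self)

lemma centred_gaussian_pair:
  assumes "x \<in> B" "y \<in> B"
  shows "centred_gaussian_rv M (\<lambda>\<omega>. a * \<phi> x \<omega> + b * \<phi> y \<omega>)
    (a\<^sup>2 * K x x + 2 * a * b * K x y + b\<^sup>2 * K y y)"
proof -
  define c where "c = (\<lambda>z. (if z = x then a else 0) + (if z = y then b else 0))"
  have sum_c: "(\<Sum>z\<in>B. c z * f z) = a * f x + b * f y" for f
    using assms finite_B
    by (simp add: c_def distrib_right sum.distrib if_distrib[of "\<lambda>c. c * _"] cong: if_cong)
  have "(\<Sum>z\<in>B. \<Sum>w\<in>B. c z * c w * K z w) = (\<Sum>z\<in>B. c z * (\<Sum>w\<in>B. c w * K z w))"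
    by (simp add: sum_distrib_left mult.assoc)
  also have "\<dots> = a\<^sup>2 * K x x + 2 * a * b * K x y + b\<^sup>2 * K y y"
    unfolding sum_c using K_sym[OF assms] by (simp add: power2_eq_square algebra_simps)
  finally show ?thesis using gaussian[of c] unfolding sum_c by simp
qed

lemma centred_gaussian_\<phi>: "x \<in> B \<Longrightarrow> centred_gaussian_rv M (\<phi> x) (K x x)"
  using centred_gaussian_pair[of x x 1 0] by simp

lemma centred_gaussian_residual:
  assumes "x \<in> B" "y \<in> B"
  shows "centred_gaussian_rv M (residual x y) (K y y - slope x y * K x y)"
proof -
  have "(- slope x y)\<^sup>2 * K x x + 2 * (- slope x y) * 1 * K x y + 1\<^sup>2 * K y y
      = K y y - slope x y * K x y"
    using K_diag_pos[OF assms(1)] by (simp add: slope_def power2_eq_square field_simps)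
  then show ?thesis
    using centred_gaussian_pair[OF assms, of "- slope x y" 1]
    by (simp add: residual_def[abs_def] mult.commute)
qed

lemma variance_shift:
  assumes x: "x \<in> B" and s: "s * K x x = (\<Sum>y\<in>B. t y * K x y)"
  defines "t' \<equiv> \<lambda>y. t y - (if y = x then s else 0)"
  shows "(\<Sum>y\<in>B. \<Sum>z\<in>B. t' y * t' z * K y z) = (\<Sum>y\<in>B. \<Sum>z\<in>B. t y * t z * K y z) - s\<^sup>2 * K x x"
proof -
  have shift: "(\<Sum>y\<in>B. t' y * f y) = (\<Sum>y\<in>B. t y * f y) - s * f x" for f
    using x finite_B
    by (simp add: t'_def left_diff_distrib sum_subtractf if_distrib[of "\<lambda>c. c * _"] cong: if_cong)
  have column: "(\<Sum>y\<in>B. t y * K y x) = s * K x x"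
    unfolding s by (intro sum.cong refl arg_cong2[where f = "(*)"] K_sym x)
  define r where "r = (\<lambda>y. \<Sum>z\<in>B. t z * K y z)"
  have "(\<Sum>y\<in>B. \<Sum>z\<in>B. t' y * t' z * K y z) = (\<Sum>y\<in>B. t' y * (\<Sum>z\<in>B. t' z * K y z))"
    by (simp add: sum_distrib_left mult.assoc)
  also have "\<dots> = (\<Sum>y\<in>B. t y * (r y - s * K y x)) - s * (r x - s * K x x)"
    unfolding shift r_def ..
  also have "(\<Sum>y\<in>B. t y * (r y - s * K y x)) = (\<Sum>y\<in>B. t y * r y) - s * (s * K x x)"
    unfolding column[symmetric]
    by (simp add: right_diff_distrib sum_subtractf sum_distrib_left mult.left_commute)
  also have "r x = s * K x x" using s by (simp add: r_def)
  finally show ?thesis by (simp add: r_def sum_distrib_left mult.assoc power2_eq_square)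
qed

abbreviation resampled :: "'i \<Rightarrow> 'i \<Rightarrow> 'a \<Rightarrow> 'a \<Rightarrow> real" where
  "resampled x y a b \<equiv> residual x y a + slope x y * \<phi> x b"

text \<open>The field has the law of \<open>resampled x y a b\<close> for independent \<open>a\<close> and \<open>b\<close>,
  because both have the same characteristic function.\<close>

lemma char_resampled:
  assumes x: "x \<in> B"
  shows "(\<integral>z. iexp (\<Sum>y\<in>B. t y * resampled x y (fst z) (snd z)) \<partial>(M \<Otimes>\<^sub>M M))
    = (\<integral>\<omega>. iexp (\<Sum>y\<in>B. t y * \<phi> y \<omega>) \<partial>M)"
proof -
  interpret P: pair_prob_space M M ..
  define s where "s = (\<Sum>y\<in>B. t y * slope x y)"
  define t' where "t' = (\<lambda>y. t y - (if y = x then s else 0))"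
  let ?v = "\<Sum>y\<in>B. \<Sum>z\<in>B. t y * t z * K y z"
  have s: "s * K x x = (\<Sum>y\<in>B. t y * K x y)"
    using K_diag_pos[OF x] by (simp add: s_def slope_def sum_distrib_right)
  have "(\<Sum>y\<in>B. t y * resampled x y a b) = (\<Sum>y\<in>B. t' y * \<phi> y a) + s * \<phi> x b" for a b
    using x finite_B
    by (simp add: residual_def t'_def s_def algebra_simps sum.distrib sum_subtractf sum_distrib_left
        if_distrib[of "\<lambda>c. _ * c"] cong: if_cong)
  then have "(\<integral>z. iexp (\<Sum>y\<in>B. t y * resampled x y (fst z) (snd z)) \<partial>(M \<Otimes>\<^sub>M M))
      = (\<integral>z. iexp (\<Sum>y\<in>B. t' y * \<phi> y (fst z)) * iexp (s * \<phi> x (snd z)) \<partial>(M \<Otimes>\<^sub>M M))"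
    by (simp add: distrib_left exp_add del: of_real_mult of_real_sum)
  also have "\<dots> = (\<integral>a. \<integral>b. iexp (\<Sum>y\<in>B. t' y * \<phi> y a) * iexp (s * \<phi> x b) \<partial>M \<partial>M)"
    by (subst P.integral_fst'[symmetric])
      (auto intro!: P.P.integrable_norm_le[where c = 1] simp: norm_mult
        simp del: of_real_mult of_real_sum)
  also have "\<dots> = (\<integral>a. iexp (\<Sum>y\<in>B. t' y * \<phi> y a) \<partial>M) * (\<integral>b. iexp (s * \<phi> x b) \<partial>M)"
    by simp
  also have "(\<integral>b. iexp (s * \<phi> x b) \<partial>M) = exp (- (s\<^sup>2 * K x x) / 2)"
    using centred_gaussian_pair[OF x x, of s 0] centred_gaussian_char by force
  also have "(\<integral>a. iexp (\<Sum>y\<in>B. t' y * \<phi> y a) \<partial>M) = exp (- (?v - s\<^sup>2 * K x x) / 2)"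
    using centred_gaussian_char[OF gaussian[of t']] variance_shift[OF x s] by (simp add: t'_def)
  also have "complex_of_real (exp (- (?v - s\<^sup>2 * K x x) / 2)) * exp (- (s\<^sup>2 * K x x) / 2)
      = exp (- ?v / 2)"
    by (simp only: of_real_mult[symmetric] exp_add[symmetric]) (simp add: diff_divide_distrib)
  also have "\<dots> = (\<integral>\<omega>. iexp (\<Sum>y\<in>B. t y * \<phi> y \<omega>) \<partial>M)"
    by (rule centred_gaussian_char[OF gaussian, symmetric])
  finally show ?thesis .
qed

lemma integral_resampled:
  fixes F :: "('i \<Rightarrow> real) \<Rightarrow> real"
  assumes x: "x \<in> B" and F [measurable]: "F \<in> borel_measurable (\<Pi>\<^sub>M y\<in>B. borel)"
    and bound: "\<And>f. \<bar>F f\<bar> \<le> c"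
  shows "(\<integral>\<omega>. F (\<lambda>y\<in>B. \<phi> y \<omega>) \<partial>M) = (\<integral>a. \<integral>b. F (\<lambda>y\<in>B. resampled x y a b) \<partial>M \<partial>M)"
proof -
  interpret P: pair_prob_space M M ..
  let ?law = "\<lambda>z. \<lambda>y\<in>B. resampled x y (fst z) (snd z)"
  have "distr M (\<Pi>\<^sub>M y\<in>B. borel) (\<lambda>\<omega>. \<lambda>y\<in>B. \<phi> y \<omega>) = distr (M \<Otimes>\<^sub>M M) (\<Pi>\<^sub>M y\<in>B. borel) ?law"
    by (rule distr_PiM_eqI_char)
      (use finite_B char_resampled[OF x] in \<open>auto intro: finite_measure_axioms P.P.finite_measure_axioms\<close>)
  then have "(\<integral>f. F f \<partial>distr M (\<Pi>\<^sub>M y\<in>B. borel) (\<lambda>\<omega>. \<lambda>y\<in>B. \<phi> y \<omega>))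
      = (\<integral>f. F f \<partial>distr (M \<Otimes>\<^sub>M M) (\<Pi>\<^sub>M y\<in>B. borel) ?law)" by simp
  then have "(\<integral>\<omega>. F (\<lambda>y\<in>B. \<phi> y \<omega>) \<partial>M) = (\<integral>z. F (?law z) \<partial>(M \<Otimes>\<^sub>M M))"
    by (simp add: integral_distr)
  also have "\<dots> = (\<integral>a. \<integral>b. F (?law (a, b)) \<partial>M \<partial>M)"
    using bound by (intro P.integral_fst'[symmetric] P.P.integrable_norm_le[where c = c]) auto
  finally show ?thesis by simp
qed

abbreviation exceedance :: "real \<Rightarrow> 'i \<Rightarrow> 'a set" where
  "exceedance u x \<equiv> {\<omega> \<in> space M. u \<le> \<phi> x \<omega>}"

lemma integral_exceedances_resampled:
  fixes G :: "'i set \<Rightarrow> real" and p :: real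
  assumes x: "x \<in> B" and p: "0 \<le> p" "p \<le> 1"
  shows "(\<integral>\<omega>. (indicator (exceedance u x) \<omega> - p) * G {y \<in> B. \<omega> \<in> exceedance u y} \<partial>M)
    = (\<integral>a. \<integral>b. (indicator {u..} (\<phi> x b) - p) * G {y \<in> B. u \<le> resampled x y a b} \<partial>M \<partial>M)"
proof -
  define F where "F = (\<lambda>f. (indicator {u..} (f x) - p) * G {y \<in> B. u \<le> f y})"
  have "(\<lambda>f. G {y \<in> B. u \<le> f y}) \<in> borel_measurable (\<Pi>\<^sub>M y\<in>B. borel)"
    using finite_B by (intro measurable_function_of_satisfied) auto
  then have F_measurable: "F \<in> borel_measurable (\<Pi>\<^sub>M y\<in>B. borel)"
    unfolding F_def using x by measurable
  have F_bound: "\<bar>F f\<bar> \<le> 1 * (\<Sum>S\<in>Pow B. \<bar>G S\<bar>)" for f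
    unfolding F_def abs_mult using p finite_B
    by (intro mult_mono abs_function_of_subset_le) (auto simp: indicator_def)
  have "(\<integral>\<omega>. (indicator (exceedance u x) \<omega> - p) * G {y \<in> B. \<omega> \<in> exceedance u y} \<partial>M)
      = (\<integral>\<omega>. F (\<lambda>y\<in>B. \<phi> y \<omega>) \<partial>M)"
    using x
    by (intro Bochner_Integration.integral_cong) (auto simp: F_def indicator_def cong: conj_cong)
  also have "\<dots> = (\<integral>a. \<integral>b. F (\<lambda>y\<in>B. resampled x y a b) \<partial>M \<partial>M)"
    by (rule integral_resampled[OF x F_measurable F_bound])
  finally show ?thesis
    using x by (simp add: F_def residual_self slope_self cong: conj_cong)
qed

lemma positively_related_exceedances: "positively_related_events M B (exceedance u)"
proof
  fix x and G :: "'i set \<Rightarrow> real"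
  assume x: "x \<in> B" and G: "mono_on (Pow B) G"
  have "0 \<le> (\<integral>b. (indicator {u..} (\<phi> x b) - prob (exceedance u x))
      * G {y \<in> B. u \<le> resampled x y a b} \<partial>M)" for a
  proof -
    define k where "k = (\<lambda>s. G {y \<in> B. u \<le> residual x y a + slope x y * s})"
    have "mono k"
    proof (rule monoI)
      fix s t :: real assume "s \<le> t"
      then have "slope x y * s \<le> slope x y * t" if "y \<in> B" for y
        using slope_nonneg[OF x that] by (rule mult_left_mono)
      then show "k s \<le> k t" unfolding k_def by (intro mono_onD[OF G]) fastforce+
    qed
    moreover have "\<bar>k s\<bar> \<le> (\<Sum>S\<in>Pow B. \<bar>G S\<bar>)" for s
      unfolding k_def by (rule abs_function_of_subset_le[OF finite_B])
    moreover have "(\<lambda>\<omega>. k (\<phi> x \<omega>)) \<in> borel_measurable M"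
      unfolding k_def using finite_B by (intro measurable_function_of_satisfied) auto
    ultimately have "0 \<le> (\<integral>b. (indicator {u..} (\<phi> x b) - prob (exceedance u x)) * k (\<phi> x b) \<partial>M)"
      by (intro integral_centred_mult_mono_nonneg) auto
    then show ?thesis by (simp add: k_def)
  qed
  then show "0 \<le> (\<integral>\<omega>. (indicator (exceedance u x) \<omega> - prob (exceedance u x))
      * G {y \<in> B. \<omega> \<in> exceedance u y} \<partial>M)"
    by (subst integral_exceedances_resampled[OF x]) (auto intro: Bochner_Integration.integral_nonneg)
qed (use finite_B in auto)

lemma prob_exceedance_residual:
  assumes x: "x \<in> B" and y: "y \<in> B"
  shows "prob {\<omega> \<in> space M. u \<le> \<phi> x \<omega> \<and> c \<le> residual x y \<omega>}
    = prob (exceedance u x) * prob {\<omega> \<in> space M. c \<le> residual x y \<omega>}"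
proof -
  define F :: "('i \<Rightarrow> real) \<Rightarrow> real" where
    "F = (\<lambda>f. indicator {u..} (f x) * indicator {c..} (f y - slope x y * f x))"
  have F_measurable: "F \<in> borel_measurable (\<Pi>\<^sub>M y\<in>B. borel)"
    unfolding F_def using x y by measurable
  have F_bound: "\<bar>F f\<bar> \<le> 1" for f by (simp add: F_def indicator_def)
  have prob_ge: "prob {\<omega> \<in> space M. s \<le> X \<omega>} = (\<integral>\<omega>. indicator {s..} (X \<omega>) \<partial>M)"
    if [measurable]: "X \<in> borel_measurable M" for X :: "'a \<Rightarrow> real" and s
    by (rule prob_Collect_eq_integral) (auto simp: indicator_def)
  have "prob {\<omega> \<in> space M. u \<le> \<phi> x \<omega> \<and> c \<le> residual x y \<omega>} = (\<integral>\<omega>. F (\<lambda>y\<in>B. \<phi> y \<omega>) \<partial>M)"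
    using x y by (intro prob_Collect_eq_integral) (auto simp: F_def indicator_def residual_def)
  also have "\<dots> = (\<integral>a. \<integral>b. F (\<lambda>y\<in>B. resampled x y a b) \<partial>M \<partial>M)"
    by (rule integral_resampled[OF x F_measurable F_bound])
  also have "\<dots> = (\<integral>a. \<integral>b. indicator {u..} (\<phi> x b) * indicator {c..} (residual x y a) \<partial>M \<partial>M)"
    using x y by (simp add: F_def residual_self slope_self)
  also have "\<dots> = prob (exceedance u x) * prob {\<omega> \<in> space M. c \<le> residual x y \<omega>}"
    by (simp add: prob_ge)
  finally show ?thesis .
qed

lemma event_cov_exceedance_le_near:
  assumes "x \<in> B" "y \<in> B" "0 \<le> u" and V: "K x x + K y y + 2 * K x y \<le> V"
  shows "event_cov (exceedance u x) (exceedance u y) \<le> exp (- (2 * u\<^sup>2 / V))"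
proof -
  have sum_gaussian: "centred_gaussian_rv M (\<lambda>\<omega>. \<phi> x \<omega> + \<phi> y \<omega>) (K x x + K y y + 2 * K x y)"
    using centred_gaussian_pair[OF assms(1,2), of 1 1] by (simp add: algebra_simps)
  have "event_cov (exceedance u x) (exceedance u y) \<le> prob (exceedance u x \<inter> exceedance u y)"
    by (simp add: event_cov_def)
  also have "\<dots> \<le> prob {\<omega> \<in> space M. 2 * u \<le> \<phi> x \<omega> + \<phi> y \<omega>}"
    by (intro finite_measure_mono) auto
  also have "\<dots> \<le> exp (- (2 * u)\<^sup>2 / (2 * V))"
    using assms K_diag_pos[of x] K_diag_pos[of y] K_nonneg[of x y]
    by (intro prob_centred_gaussian_ge_le_exp[OF sum_gaussian]) auto
  also have "- (2 * u)\<^sup>2 / (2 * V) = - (2 * u\<^sup>2 / V)" by (simp add: power_mult_distrib)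
  finally show ?thesis .
qed

text \<open>Unless the value at \<open>x\<close> reaches \<open>2 u\<close>, an exceedance at \<open>y\<close> forces the independent residual to
  be at least \<open>(1 - 2 * slope x y) * u\<close>.\<close>

lemma event_cov_exceedance_le_residual:
  assumes x: "x \<in> B" and y: "y \<in> B"
  shows "event_cov (exceedance u x) (exceedance u y) \<le> prob (exceedance (2 * u) x)
    + prob (exceedance u x)
      * (prob {\<omega> \<in> space M. (1 - 2 * slope x y) * u \<le> residual x y \<omega>} - prob (exceedance u y))"
proof -
  let ?R = "{\<omega> \<in> space M. (1 - 2 * slope x y) * u \<le> residual x y \<omega>}"
  have "exceedance u x \<inter> exceedance u y \<subseteq> exceedance (2 * u) x \<union> (exceedance u x \<inter> ?R)"
  proof
    fix \<omega> assume \<omega>: "\<omega> \<in> exceedance u x \<inter> exceedance u y"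
    show "\<omega> \<in> exceedance (2 * u) x \<union> (exceedance u x \<inter> ?R)"
    proof (cases "2 * u \<le> \<phi> x \<omega>")
      case False
      then have "slope x y * \<phi> x \<omega> \<le> slope x y * (2 * u)"
        using slope_nonneg[OF x y] by (intro mult_left_mono) auto
      then show ?thesis using \<omega> by (auto simp: residual_def algebra_simps)
    qed (use \<omega> in auto)
  qed
  then have "prob (exceedance u x \<inter> exceedance u y)
      \<le> prob (exceedance (2 * u) x \<union> (exceedance u x \<inter> ?R))"
    by (intro finite_measure_mono) auto
  also have "\<dots> \<le> prob (exceedance (2 * u) x) + prob (exceedance u x \<inter> ?R)"
    by (intro measure_Un_le) auto
  also have "exceedance u x \<inter> ?R = {\<omega> \<in> space M. u \<le> \<phi> x \<omega> \<and> (1 - 2 * slope x y) * u \<le> residual x y \<omega>}"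
    by auto
  finally show ?thesis
    unfolding prob_exceedance_residual[OF x y] by (simp add: event_cov_def algebra_simps)
qed

lemma prob_residual_diff_le:
  assumes x: "x \<in> B" and y: "y \<in> B" and u: "0 \<le> u"
    and diag: "1 \<le> K x x" "1 \<le> K y y" "K y y \<le> V" and \<epsilon>: "K x y \<le> \<epsilon>" "\<epsilon> \<le> 1 / 4"
  shows "prob {\<omega> \<in> space M. (1 - 2 * slope x y) * u \<le> residual x y \<omega>} - prob (exceedance u y)
    \<le> 4 * K x y * u * exp (- ((1 - 2 * \<epsilon>)\<^sup>2 * u\<^sup>2 / (2 * V)))"
proof -
  define b where "b = slope x y"
  define v where "v = K y y - b * K x y"
  have b: "0 \<le> b" "b \<le> K x y" "b \<le> 1 / 4"
    using slope_nonneg[OF x y] K_nonneg[OF x y] diag \<epsilon>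
    by (auto simp: b_def slope_def divide_le_eq mult_le_cancel_left1)
  have "b * K x y \<le> 1 / 4 * (1 / 4)"
    using b \<epsilon> K_nonneg[OF x y] by (intro mult_mono) auto
  then have v: "1 / 4 \<le> v" "v \<le> K y y" "v \<le> V"
    using diag mult_nonneg_nonneg[OF b(1) K_nonneg[OF x y]] by (auto simp: v_def)
  have sqrt_v: "1 / 2 \<le> sqrt v" using v by (intro real_le_rsqrt) (auto simp: power_divide)
  have "b * u \<le> \<epsilon> * u" "\<epsilon> * u \<le> 1 / 4 * u"
    using b \<epsilon> by (intro mult_right_mono u; simp)+
  then have levels: "0 \<le> (1 - 2 * \<epsilon>) * u" "(1 - 2 * \<epsilon>) * u \<le> (1 - 2 * b) * u" "(1 - 2 * b) * u \<le> u"
    using u b by (auto simp: algebra_simps)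
  have "prob {\<omega> \<in> space M. (1 - 2 * b) * u \<le> residual x y \<omega>} - prob (exceedance u y)
      = normal_tail ((1 - 2 * b) * u / sqrt v) - normal_tail (u / sqrt (K y y))"
    using centred_gaussian_residual[OF x y] centred_gaussian_\<phi>[OF y] v diag
    by (simp add: prob_centred_gaussian_ge v_def b_def)
  also have "\<dots> \<le> normal_tail ((1 - 2 * b) * u / sqrt v) - normal_tail (u / sqrt v)"
    using u v by (intro diff_left_mono normal_tail_antimono divide_left_mono) auto
  also have "\<dots> \<le> (u / sqrt v - (1 - 2 * b) * u / sqrt v) * exp (- ((1 - 2 * b) * u / sqrt v)\<^sup>2 / 2)"
    using levels v by (intro normal_tail_diff_le divide_right_mono) auto
  also have "\<dots> \<le> (4 * K x y * u) * exp (- ((1 - 2 * \<epsilon>)\<^sup>2 * u\<^sup>2 / (2 * V)))"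
  proof (intro mult_mono)
    have "u / sqrt v - (1 - 2 * b) * u / sqrt v = 2 * b * u / sqrt v"
      by (simp add: diff_divide_distrib[symmetric] algebra_simps)
    also have "\<dots> \<le> 2 * b * u / (1 / 2)" using b u sqrt_v v by (intro divide_left_mono) auto
    also have "\<dots> \<le> 4 * K x y * u" using b u by (simp add: mult_right_mono)
    finally show "u / sqrt v - (1 - 2 * b) * u / sqrt v \<le> 4 * K x y * u" .
    have "((1 - 2 * \<epsilon>) * u)\<^sup>2 / (2 * V) \<le> ((1 - 2 * b) * u)\<^sup>2 / (2 * v)"
      using levels v by (intro frac_le power_mono) auto
    then show "exp (- ((1 - 2 * b) * u / sqrt v)\<^sup>2 / 2) \<le> exp (- ((1 - 2 * \<epsilon>)\<^sup>2 * u\<^sup>2 / (2 * V)))"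
      using v by (simp add: power_divide power_mult_distrib)
  qed (use K_nonneg[OF x y] u in auto)
  finally show ?thesis by (simp add: b_def)
qed

lemma event_cov_exceedance_le_far:
  assumes x: "x \<in> B" and y: "y \<in> B" and u: "0 \<le> u"
    and diag: "1 \<le> K x x" "1 \<le> K y y" "K x x \<le> V" "K y y \<le> V" and \<epsilon>: "K x y \<le> \<epsilon>" "\<epsilon> \<le> 1 / 4"
  shows "event_cov (exceedance u x) (exceedance u y) \<le> exp (- (2 * u\<^sup>2 / V))
    + 4 * K x y * u * exp (- ((1 + (1 - 2 * \<epsilon>)\<^sup>2) * u\<^sup>2 / (2 * V)))"
proof -
  let ?e = "exp (- ((1 - 2 * \<epsilon>)\<^sup>2 * u\<^sup>2 / (2 * V)))"
  have tail: "prob (exceedance s x) \<le> exp (- s\<^sup>2 / (2 * V))" if "0 \<le> s" for s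
    using that diag by (intro prob_centred_gaussian_ge_le_exp[OF centred_gaussian_\<phi>[OF x]]) auto
  have "prob (exceedance u x)
      * (prob {\<omega> \<in> space M. (1 - 2 * slope x y) * u \<le> residual x y \<omega>} - prob (exceedance u y))
      \<le> prob (exceedance u x) * (4 * K x y * u * ?e)"
    by (intro mult_left_mono prob_residual_diff_le assms) simp
  also have "\<dots> \<le> exp (- u\<^sup>2 / (2 * V)) * (4 * K x y * u * ?e)"
    using tail[OF u] K_nonneg[OF x y] u by (intro mult_right_mono) auto
  also have "\<dots> = 4 * K x y * u * exp (- ((1 + (1 - 2 * \<epsilon>)\<^sup>2) * u\<^sup>2 / (2 * V)))"
    by (simp add: exp_add[symmetric] add_divide_distrib distrib_right mult.left_commute)
  finally have residual_term: "prob (exceedance u x)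
      * (prob {\<omega> \<in> space M. (1 - 2 * slope x y) * u \<le> residual x y \<omega>} - prob (exceedance u y))
      \<le> 4 * K x y * u * exp (- ((1 + (1 - 2 * \<epsilon>)\<^sup>2) * u\<^sup>2 / (2 * V)))" .
  have "prob (exceedance (2 * u) x) \<le> exp (- (2 * u\<^sup>2 / V))"
    using tail[of "2 * u"] u by (simp add: power_mult_distrib)
  then show ?thesis
    using event_cov_exceedance_le_residual[OF x y, of u] residual_term by linarith
qed

end

subsection \<open>High points of the free field\<close>

lemma bulk_subset_box_int:
  assumes "0 < \<delta>" "0 < n"
  shows "bulk \<delta> n \<subseteq> box_int n"
proof
  fix x :: "int ^ 'a" assume x: "x \<in> bulk \<delta> n"
  have "0 < x $ i \<and> x $ i < int n" for i
  proof -
    have "\<delta> * real n \<le> real_of_int (x $ i)" "real_of_int (x $ i) \<le> (1 - \<delta>) * real n"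
      using x by (auto simp: bulk_def)
    moreover have "0 < \<delta> * real n" using assms by simp
    ultimately have "0 < real_of_int (x $ i)" "real_of_int (x $ i) < real n"
      by (auto simp: algebra_simps)
    then show ?thesis by linarith
  qed
  then show "x \<in> box_int n" by (simp add: box_int_def)
qed

lemma exp_hp_level:
  assumes d3: "CARD('d::finite) \<ge> 3" and "0 \<le> \<alpha>" "0 < n"
  shows "exp (- (c * (hp_level TYPE('d) \<alpha> n)\<^sup>2 / (2 * green0 TYPE('d))))
      = real n powr (- (c * \<alpha> * real CARD('d)))"
proof -
  have V: "1 \<le> green0 TYPE('d)"
    using walk_green_diag_ge_1[OF d3] by (simp add: green0_eq_walk_green)
  then have "(hp_level TYPE('d) \<alpha> n)\<^sup>2 = 2 * \<alpha> * real CARD('d) * green0 TYPE('d) * ln (real n)"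
    using assms by (simp add: hp_level_def)
  then show ?thesis using V assms(3) by (simp add: powr_def)
qed

locale dgff =
  fixes n :: nat and M :: "'a measure" and \<phi> :: "int ^ 'd::finite \<Rightarrow> 'a \<Rightarrow> real"
  assumes d3: "CARD('d) \<ge> 3" and is_dgff: "is_dgff n M \<phi>"

sublocale dgff \<subseteq> gaussian_family M "box_int n" "green_box n" \<phi>
proof -
  interpret prob_space M using is_dgff by (simp add: is_dgff_def)
  have gaussian: "centred_gaussian_rv M (\<lambda>\<omega>. \<Sum>x\<in>box_int n. c x * \<phi> x \<omega>)
      (\<Sum>x\<in>box_int n. \<Sum>y\<in>box_int n. c x * c y * green_box n x y)" for c
    using is_dgff by (simp add: is_dgff_def)
  have "\<phi> x \<in> borel_measurable M" for x
  proof (cases "x \<in> box_int n")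
    case True
    have "(\<lambda>\<omega>. \<Sum>z\<in>box_int n. (if z = x then 1 else 0) * \<phi> z \<omega>) \<in> borel_measurable M"
      using gaussian[of "\<lambda>z. if z = x then 1 else 0"] unfolding centred_gaussian_rv_def by blast
    then show ?thesis using True by (simp add: if_distrib[of "\<lambda>c. c * _"] cong: if_cong)
  next
    case False
    then have "\<phi> x = (\<lambda>_. 0)" using is_dgff by (auto simp: is_dgff_def)
    then show ?thesis by simp
  qed
  moreover have "0 < green_box n x x" for x :: "int ^ 'd"
    using walk_green_diag_ge_1[OF d3, of "box_int n" x] by (simp add: green_box_eq_walk_green)
  ultimately show "gaussian_family M (box_int n) (green_box n) \<phi>"
    using gaussian walk_green_nonneg[OF d3] walk_green_sym
    by unfold_locales (auto simp: green_box_eq_walk_green)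
qed

context dgff
begin

abbreviation high :: "real \<Rightarrow> int ^ 'd \<Rightarrow> 'a set" where
  "high \<alpha> \<equiv> exceedance (hp_level TYPE('d) \<alpha> n)"

lemma finite_bulk:
  assumes "0 < \<delta>" "0 < n"
  shows "finite (bulk \<delta> n :: (int ^ 'd) set)"
  using bulk_subset_box_int[OF assms] finite_box_int by (rule finite_subset)

lemma tv_high_nonneg:
  assumes "0 < \<delta>" "0 < n"
  shows "0 \<le> tv_high M \<delta> \<alpha> n \<phi>"
  unfolding tv_high_def using finite_bulk[OF assms] by (subst Max_ge_iff) auto

lemma tv_high_le_sum_event_cov:
  assumes \<delta>: "0 < \<delta>" and n: "0 < n"
  shows "tv_high M \<delta> \<alpha> n \<phi> \<le> 2 * (\<Sum>x\<in>bulk \<delta> n. \<Sum>y\<in>bulk \<delta> n - {x}. event_cov (high \<alpha> x) (high \<alpha> y))"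
proof -
  interpret high: positively_related_events M "box_int n" "high \<alpha>"
    by (rule positively_related_exceedances)
  let ?D = "bulk \<delta> n :: (int ^ 'd) set"
  have "\<bar>prob {\<omega> \<in> space M. high_points \<delta> \<alpha> n \<phi> \<omega> \<in> \<A>} - bern_law M \<delta> \<alpha> n \<phi> \<A>\<bar>
      \<le> 2 * (\<Sum>x\<in>?D. \<Sum>y\<in>?D - {x}. event_cov (high \<alpha> x) (high \<alpha> y))" for \<A>
  proof -
    have "{\<omega> \<in> space M. high_points \<delta> \<alpha> n \<phi> \<omega> \<in> \<A>} = {\<omega> \<in> space M. {y \<in> ?D. \<omega> \<in> high \<alpha> y} \<in> \<A>}"
      by (simp add: high_points_def cong: conj_cong)
    moreover have "bern_law M \<delta> \<alpha> n \<phi> \<A> = (\<Sum>S\<in>\<A> \<inter> Pow ?D. bernoulli_weight (\<lambda>x. prob (high \<alpha> x)) ?D S)"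
      by (simp add: bern_law_def bernoulli_weight_def)
    ultimately show ?thesis
      using high.abs_prob_occurring_diff_bernoulli_le[OF bulk_subset_box_int[OF assms], of \<A>] by simp
  qed
  then show ?thesis
    unfolding tv_high_def using finite_bulk[OF assms] by (subst Max_le_iff) auto
qed

lemma green_box_diag_bounds:
  "1 \<le> green_box n x x" "green_box n x x \<le> green0 TYPE('d)" for x :: "int ^ 'd"
  unfolding green_box_eq_walk_green by (rule walk_green_diag_ge_1[OF d3] walk_green_le_green0[OF d3])+

lemma hp_level_nonneg: "0 \<le> \<alpha> \<Longrightarrow> 0 < n \<Longrightarrow> 0 \<le> hp_level TYPE('d) \<alpha> n"
  using green_box_diag_bounds[of 0] by (simp add: hp_level_def)

lemma event_cov_high_le_near:
  assumes "0 \<le> \<alpha>" "0 < n" and x: "x \<in> box_int n" and y: "y \<in> box_int n" and "x \<noteq> y"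
  shows "event_cov (high \<alpha> x) (high \<alpha> y)
      \<le> real n powr (- (2 * \<alpha> * real CARD('d) / (1 + hit_ratio TYPE('d))))"
proof -
  define \<rho> V u where "\<rho> = hit_ratio TYPE('d)" and "V = green0 TYPE('d)" and "u = hp_level TYPE('d) \<alpha> n"
  have \<rho>: "0 < \<rho>" using hit_ratio_bounds(1)[OF d3] by (simp add: \<rho>_def)
  have "green_box n x y \<le> \<rho> * V"
    unfolding \<rho>_def V_def green_box_eq_walk_green by (rule walk_green_le_hit_ratio[OF d3 x \<open>x \<noteq> y\<close>])
  then have "green_box n x x + green_box n y y + 2 * green_box n x y \<le> 2 * ((1 + \<rho>) * V)"
    using green_box_diag_bounds(2)[of x] green_box_diag_bounds(2)[of y]
    by (simp add: V_def algebra_simps)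
  then have "event_cov (high \<alpha> x) (high \<alpha> y) \<le> exp (- (2 * u\<^sup>2 / (2 * ((1 + \<rho>) * V))))"
    unfolding u_def using assms by (intro event_cov_exceedance_le_near hp_level_nonneg)
  also have "2 * u\<^sup>2 / (2 * ((1 + \<rho>) * V)) = 2 / (1 + \<rho>) * u\<^sup>2 / (2 * V)" using \<rho> by simp
  also have "exp (- \<dots>) = real n powr (- (2 / (1 + \<rho>) * \<alpha> * real CARD('d)))"
    unfolding u_def V_def by (rule exp_hp_level[OF d3 assms(1,2)])
  finally show ?thesis by (simp add: \<rho>_def)
qed

lemma event_cov_high_le_far:
  assumes \<alpha>: "0 \<le> \<alpha>" and n: "0 < n" and x: "x \<in> box_int n" and y: "y \<in> box_int n"
    and \<epsilon>: "green_box n x y \<le> \<epsilon>" "\<epsilon> \<le> 1 / 4"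
  shows "event_cov (high \<alpha> x) (high \<alpha> y) \<le> real n powr (- (4 * \<alpha> * real CARD('d)))
    + 4 * hp_level TYPE('d) \<alpha> n * real n powr (- ((1 + (1 - 2 * \<epsilon>)\<^sup>2) * \<alpha> * real CARD('d))) * green_box n x y"
proof -
  let ?u = "hp_level TYPE('d) \<alpha> n" and ?V = "green0 TYPE('d)"
  have "event_cov (high \<alpha> x) (high \<alpha> y) \<le> exp (- (2 * ?u\<^sup>2 / ?V))
      + 4 * green_box n x y * ?u * exp (- ((1 + (1 - 2 * \<epsilon>)\<^sup>2) * ?u\<^sup>2 / (2 * ?V)))"
    by (intro event_cov_exceedance_le_far hp_level_nonneg green_box_diag_bounds assms)
  moreover have "2 * ?u\<^sup>2 / ?V = 4 * ?u\<^sup>2 / (2 * ?V)" by simp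
  ultimately show ?thesis by (simp only: exp_hp_level[OF d3 \<alpha> n]) (simp add: mult_ac)
qed

lemma sum_event_cov_high_le:
  assumes \<alpha>: "0 \<le> \<alpha>" and n: "0 < n" and D: "D \<subseteq> box_int n" and x: "x \<in> D" and \<epsilon>: "\<epsilon> \<le> 1 / 4"
    and far: "\<And>y. y \<notin> sup_ball r x \<Longrightarrow> green_box n x y \<le> \<epsilon>"
  defines "d \<equiv> real CARD('d)"
  shows "(\<Sum>y\<in>D - {x}. event_cov (high \<alpha> x) (high \<alpha> y))
    \<le> real ((2 * r + 1) ^ CARD('d)) * real n powr (- (2 * \<alpha> * d / (1 + hit_ratio TYPE('d))))
      + real n powr d * real n powr (- (4 * \<alpha> * d))
      + 4 * d * hp_level TYPE('d) \<alpha> n * ((real n)\<^sup>2 * real n powr (- ((1 + (1 - 2 * \<epsilon>)\<^sup>2) * \<alpha> * d)))"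
proof -
  let ?u = "hp_level TYPE('d) \<alpha> n" and ?N = "sup_ball r x"
  let ?near = "real n powr (- (2 * \<alpha> * d / (1 + hit_ratio TYPE('d))))"
    and ?uncorrelated = "real n powr (- (4 * \<alpha> * d))"
    and ?far = "real n powr (- ((1 + (1 - 2 * \<epsilon>)\<^sup>2) * \<alpha> * d))"
  have finD: "finite D" using D finite_box_int finite_subset by blast
  have xB: "x \<in> box_int n" using x D by auto
  have u: "0 \<le> ?u" by (rule hp_level_nonneg[OF \<alpha> n])
  have green_nonneg: "0 \<le> green_box n x y" for y
    unfolding green_box_eq_walk_green by (rule walk_green_nonneg[OF d3])
  have "(\<Sum>y\<in>(D - {x}) \<inter> ?N. event_cov (high \<alpha> x) (high \<alpha> y)) \<le> (\<Sum>y\<in>(D - {x}) \<inter> ?N. ?near)"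
    unfolding d_def using D xB by (intro sum_mono event_cov_high_le_near \<alpha> n) auto
  also have "\<dots> \<le> real ((2 * r + 1) ^ CARD('d)) * ?near"
    using card_mono[OF finite_card_sup_ball(1), of "(D - {x}) \<inter> ?N" r x]
    by (simp add: finite_card_sup_ball(2) mult_right_mono flip: of_nat_power)
  finally have near: "(\<Sum>y\<in>(D - {x}) \<inter> ?N. event_cov (high \<alpha> x) (high \<alpha> y)) \<le> \<dots>" .
  have "(\<Sum>y\<in>(D - {x}) - ?N. event_cov (high \<alpha> x) (high \<alpha> y))
      \<le> (\<Sum>y\<in>(D - {x}) - ?N. ?uncorrelated + 4 * ?u * ?far * green_box n x y)"
    unfolding d_def using D xB by (intro sum_mono event_cov_high_le_far \<alpha> n far \<epsilon>) auto
  also have "\<dots> \<le> (\<Sum>y\<in>box_int n. ?uncorrelated + 4 * ?u * ?far * green_box n x y)"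
    using D u green_nonneg by (intro sum_mono2 add_nonneg_nonneg mult_nonneg_nonneg) auto
  also have "\<dots> = real (card (box_int n :: (int ^ 'd) set)) * ?uncorrelated
      + 4 * ?u * ?far * (\<Sum>y\<in>box_int n. green_box n x y)"
    by (simp add: sum.distrib sum_distrib_left)
  also have "\<dots> \<le> real n powr d * ?uncorrelated + 4 * ?u * ?far * (d * (real n)\<^sup>2)"
  proof (intro add_mono mult_left_mono mult_right_mono)
    show "real (card (box_int n :: (int ^ 'd) set)) \<le> real n powr d"
      using card_box_int_le[of n, where 'd = 'd] n by (simp add: d_def powr_realpow flip: of_nat_power)
    show "(\<Sum>y\<in>box_int n. green_box n x y) \<le> d * (real n)\<^sup>2"
      unfolding d_def by (rule sum_green_box_le[OF d3 xB])
  qed (use u in auto)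
  finally have "(\<Sum>y\<in>(D - {x}) - ?N. event_cov (high \<alpha> x) (high \<alpha> y))
      \<le> real n powr d * ?uncorrelated + 4 * ?u * ?far * (d * (real n)\<^sup>2)" .
  then show ?thesis
    using near finD sum.Int_Diff[of "D - {x}" "\<lambda>y. event_cov (high \<alpha> x) (high \<alpha> y)" ?N]
    by (simp add: mult_ac)
qed

lemma tv_high_le:
  assumes \<delta>: "0 < \<delta>" and n: "0 < n" and \<alpha>: "0 \<le> \<alpha>" and \<epsilon>: "\<epsilon> \<le> 1 / 4"
    and far: "\<And>(x :: int ^ 'd) y. y \<notin> sup_ball r x \<Longrightarrow> green_box n x y \<le> \<epsilon>"
  defines "d \<equiv> real CARD('d)"
  shows "tv_high M \<delta> \<alpha> n \<phi>
    \<le> 2 * (real ((2 * r + 1) ^ CARD('d)) * real n powr (d - 2 * \<alpha> * d / (1 + hit_ratio TYPE('d)))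
      + real n powr (2 * d - 4 * \<alpha> * d)
      + 4 * d * hp_level TYPE('d) \<alpha> n * real n powr (d + 2 - (1 + (1 - 2 * \<epsilon>)\<^sup>2) * \<alpha> * d))"
proof -
  let ?D = "bulk \<delta> n :: (int ^ 'd) set"
  have D: "?D \<subseteq> box_int n" by (rule bulk_subset_box_int[OF \<delta> n])
  define row where
    "row = real ((2 * r + 1) ^ CARD('d)) * real n powr (- (2 * \<alpha> * d / (1 + hit_ratio TYPE('d))))
      + real n powr d * real n powr (- (4 * \<alpha> * d))
      + 4 * d * hp_level TYPE('d) \<alpha> n * ((real n)\<^sup>2 * real n powr (- ((1 + (1 - 2 * \<epsilon>)\<^sup>2) * \<alpha> * d)))"
  have row_nonneg: "0 \<le> row" using hp_level_nonneg[OF \<alpha> n] by (simp add: row_def d_def)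
  have "card ?D \<le> n ^ CARD('d)"
    using card_mono[OF finite_box_int D] card_box_int_le[of n, where 'd = 'd] by linarith
  then have card: "real (card ?D) \<le> real n powr d"
    using n by (simp add: d_def powr_realpow flip: of_nat_power)
  have "(\<Sum>x\<in>?D. \<Sum>y\<in>?D - {x}. event_cov (high \<alpha> x) (high \<alpha> y)) \<le> (\<Sum>x\<in>?D. row)"
    unfolding row_def d_def by (intro sum_mono sum_event_cov_high_le \<alpha> n D \<epsilon> far)
  also have "\<dots> \<le> real n powr d * row" using card row_nonneg by (simp add: mult_right_mono)
  also have "\<dots>
      = real ((2 * r + 1) ^ CARD('d)) * real n powr (d + - (2 * \<alpha> * d / (1 + hit_ratio TYPE('d))))
      + real n powr (d + d + - (4 * \<alpha> * d))
      + 4 * d * hp_level TYPE('d) \<alpha> n * real n powr (d + 2 + - ((1 + (1 - 2 * \<epsilon>)\<^sup>2) * \<alpha> * d))"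
  proof -
    have "(real n)\<^sup>2 = real n powr 2" using n by (simp add: powr_numeral)
    then show ?thesis unfolding row_def powr_add by (simp only: distrib_left mult_ac)
  qed
  finally have "(\<Sum>x\<in>?D. \<Sum>y\<in>?D - {x}. event_cov (high \<alpha> x) (high \<alpha> y)) \<le> \<dots>" .
  then show ?thesis
    by (intro order_trans[OF tv_high_le_sum_event_cov[OF \<delta> n] mult_left_mono]) auto
qed

end

lemma critical_exponents:
  fixes d \<alpha> :: real
  assumes d: "3 \<le> d" and \<alpha>: "3 / 4 * ((d - 2 / 3) / (d - 1)) < \<alpha>"
  shows "0 < \<alpha>" and "d < 2 * \<alpha> * d / (1 + d / (2 * (d - 1)))" and "d + 2 < 2 * (\<alpha> * d)"
proof -
  have "1 + d / (2 * (d - 1)) = 2 * (3 / 4 * ((d - 2 / 3) / (d - 1)))"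
    using d by (simp add: field_simps)
  also have "\<dots> < 2 * \<alpha>" using \<alpha> by (intro mult_strict_left_mono) auto
  finally have critical: "1 + d / (2 * (d - 1)) < 2 * \<alpha>" .
  moreover have "0 < 1 + d / (2 * (d - 1))" using d by (intro add_pos_pos) auto
  ultimately show "0 < \<alpha>" by simp
  have "d * (1 + d / (2 * (d - 1))) < d * (2 * \<alpha>)"
    using critical d by (intro mult_strict_left_mono) auto
  then show "d < 2 * \<alpha> * d / (1 + d / (2 * (d - 1)))"
    using d by (simp add: less_divide_eq add_pos_pos mult_ac)
  have "0 \<le> (d - 2)\<^sup>2" by simp
  then have "d + 2 \<le> d * (1 + d / (2 * (d - 1)))" using d by (simp add: field_simps power2_eq_square)
  also have "\<dots> < d * (2 * \<alpha>)" using critical d by (intro mult_strict_left_mono) auto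
  finally show "d + 2 < 2 * (\<alpha> * d)" by (simp add: mult_ac)
qed

lemma exponent_stable:
  fixes a b :: real
  assumes "b < 2 * a" and "0 < a"
  obtains \<epsilon> where "0 < \<epsilon>" "\<epsilon> \<le> 1 / 4" "b < (1 + (1 - 2 * \<epsilon>)\<^sup>2) * a"
proof
  define \<epsilon> where "\<epsilon> = min (1 / 4) ((2 * a - b) / (8 * a))"
  show "0 < \<epsilon>" "\<epsilon> \<le> 1 / 4" using assms by (auto simp: \<epsilon>_def)
  have "\<epsilon> \<le> (2 * a - b) / (8 * a)" by (simp add: \<epsilon>_def)
  then have "b < (2 - 4 * \<epsilon>) * a" using assms by (simp add: field_simps)
  also have "\<dots> \<le> (1 + (1 - 2 * \<epsilon>)\<^sup>2) * a"
    using assms by (intro mult_right_mono) (auto simp: power2_eq_square algebra_simps)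
  finally show "b < (1 + (1 - 2 * \<epsilon>)\<^sup>2) * a" .
qed

lemma tv_bound_tendsto_0:
  fixes a b c :: real
  assumes "a < 0" "b < 0" "c < 0"
  shows "(\<lambda>n. 2 * (R * real n powr a + real n powr b + C * hp_level t \<alpha> n * real n powr c)) \<longlonglongrightarrow> 0"
proof -
  define s where "s = sqrt (2 * \<alpha> * real CARD('a) * green0 t)"
  have "(\<lambda>n. real n powr a) \<longlonglongrightarrow> 0" "(\<lambda>n. real n powr b) \<longlonglongrightarrow> 0"
    "(\<lambda>n. sqrt (ln (real n)) * real n powr c) \<longlonglongrightarrow> 0"
    using assms by real_asymp+
  then have "(\<lambda>n. 2 * (R * real n powr a + real n powr b + C * s * (sqrt (ln (real n)) * real n powr c)))
      \<longlonglongrightarrow> 2 * (R * 0 + 0 + C * s * 0)"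
    by (intro tendsto_intros)
  then show ?thesis by (simp add: hp_level_def s_def real_sqrt_mult mult_ac)
qed

theorem theorem1p3:
  fixes M :: "nat \<Rightarrow> 'a measure"
    and \<phi> :: "nat \<Rightarrow> int ^ 'd::finite \<Rightarrow> 'a \<Rightarrow> real"
    and \<delta> \<alpha> :: real
  assumes "CARD('d) \<ge> 3"
    and "0 < \<delta>" and "\<delta> < 1"
    and "3 / 4 * ((real CARD('d) - 2 / 3) / (real CARD('d) - 1)) < \<alpha>" and "\<alpha> < 1"
    and "\<And>n. is_dgff n (M n) (\<phi> n)"
  shows "(\<lambda>n. tv_high (M n) \<delta> \<alpha> n (\<phi> n)) \<longlonglongrightarrow> 0"
proof -
  let ?d = "real CARD('d)" and ?\<rho> = "hit_ratio TYPE('d)"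
  have dgff: "dgff n (M n) (\<phi> n)" for n using assms by unfold_locales
  have \<alpha>: "0 < \<alpha>" and near: "?d < 2 * \<alpha> * ?d / (1 + ?\<rho>)" and far: "?d + 2 < 2 * (\<alpha> * ?d)"
    using critical_exponents[OF _ assms(4)] assms(1) by (simp_all add: hit_ratio_def)
  obtain \<epsilon> where \<epsilon>: "0 < \<epsilon>" "\<epsilon> \<le> 1 / 4" "?d + 2 < (1 + (1 - 2 * \<epsilon>)\<^sup>2) * (\<alpha> * ?d)"
    using exponent_stable[OF far] \<alpha> by auto
  obtain r where r: "\<And>n (x :: int ^ 'd) y. y \<notin> sup_ball r x \<Longrightarrow> green_box n x y \<le> \<epsilon>"
    using green_box_le_far[OF assms(1) \<epsilon>(1)] by blast
  let ?bound = "\<lambda>n. 2 * (real ((2 * r + 1) ^ CARD('d)) * real n powr (?d - 2 * \<alpha> * ?d / (1 + ?\<rho>))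
    + real n powr (2 * ?d - 4 * \<alpha> * ?d)
    + 4 * ?d * hp_level TYPE('d) \<alpha> n * real n powr (?d + 2 - (1 + (1 - 2 * \<epsilon>)\<^sup>2) * \<alpha> * ?d))"
  show ?thesis
  proof (rule tendsto_sandwich)
    show "\<forall>\<^sub>F n in sequentially. 0 \<le> tv_high (M n) \<delta> \<alpha> n (\<phi> n)"
      using eventually_gt_at_top[of 0] by eventually_elim (rule dgff.tv_high_nonneg[OF dgff assms(2)])
    show "\<forall>\<^sub>F n in sequentially. tv_high (M n) \<delta> \<alpha> n (\<phi> n) \<le> ?bound n"
      using eventually_gt_at_top[of 0]
      by eventually_elim (rule dgff.tv_high_le[OF dgff assms(2) _ less_imp_le[OF \<alpha>] \<epsilon>(2) r])
    show "?bound \<longlonglongrightarrow> 0" using near far \<epsilon>(3) by (intro tv_bound_tendsto_0; simp only: mult.assoc; linarith)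
  qed simp
qed

end
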